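(* For every integer $n\ge 2$ there exists a regular continuum that is $n$-sac but not $(n+1)$-sac.
   Context: A continuum is a compact connected metric space. A continuum is regular if it has a base (of open sets) all of whose elements have finite boundary. An arc in a space $X$ is a homeomorphic embedding $\alpha:[0,1]\to X$ (or its image). A topological space $X$ is $n$-strongly arc connected ($n$-sac) if for every $n$ distinct points $x_1,\dots,x_n$ of $X$ there are an arc $\alpha:[0,1]\to X$ and $t_1<t_2<\dots<t_n$ in $[0,1]$ such that $\alpha(t_i)=x_i$ for $i=1,\dots,n$. *)

theory Defs
  imports "HOL-Analysis.Analysis"
begin

(* The metric type of the library bundles an arbitrary carrier set with a metric on it,
   so a continuum need not exhaust its ambient type, nor carry a metric or topology
   inherited from that type. *)
definition continuum :: "'a metric \<Rightarrow> bool" where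
  "continuum m \<longleftrightarrow> compact_space (mtopology_of m) \<and> connected_space (mtopology_of m)"

(* Not to be confused with the separation axiom regular_space. *)
definition regular_continuum :: "'a metric \<Rightarrow> bool" where
  "regular_continuum m \<longleftrightarrow> continuum m \<and>
     (\<exists>\<B>. (\<forall>V\<in>\<B>. openin (mtopology_of m) V) \<and>
          (\<forall>U x. openin (mtopology_of m) U \<and> x \<in> U \<longrightarrow> (\<exists>V\<in>\<B>. x \<in> V \<and> V \<subseteq> U)) \<and>
          (\<forall>V\<in>\<B>. finite (mtopology_of m frontier_of V)))"

definition arc_in :: "'a topology \<Rightarrow> (real \<Rightarrow> 'a) \<Rightarrow> bool" where
  "arc_in X \<alpha> \<longleftrightarrow> embedding_map (top_of_set {0..1}) X \<alpha>"

(* As the times t are increasing in i, the arc meets the points in the prescribed order. *)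
definition strongly_arc_connected :: "nat \<Rightarrow> 'a topology \<Rightarrow> bool" where
  "strongly_arc_connected n X \<longleftrightarrow>
     (\<forall>x::nat \<Rightarrow> 'a. x \<in> {1..n} \<rightarrow> topspace X \<and> inj_on x {1..n} \<longrightarrow>
        (\<exists>(\<alpha>::real \<Rightarrow> 'a) (t::nat \<Rightarrow> real).
           arc_in X \<alpha> \<and> t \<in> {1..n} \<rightarrow> {0..1} \<and> strict_mono_on {1..n} t \<and>
           (\<forall>i\<in>{1..n}. \<alpha> (t i) = x i)))"

end

theory Submission
  imports Defs
begin

text \<open>
The example consists of two copies of a gasket, glued together at $m = n - 1$ points.

The gasket with $N$ corners is the attractor of the $N$ maps that halve the distance to the vertices
of a simplex. It is the union of $N$ half-size copies of itself, any two of which share exactly one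
point. Iterating, for every level $L$ it is the union of $N^L$ cells, named by words of length $L$;
two of them share at most one point, which is then a corner of both, and no point lies in more than
two of them. Removing all cells of a fine level that miss a given point leaves a small neighbourhood
of that point with finite boundary, which is why the double gasket is a regular continuum.

An arc can change from one sheet of the double to the other only in one of the $m$ seams, and it
visits each seam at most once. So it cannot visit $m + 2 = n + 1$ points that lie alternately on the
two sheets, off the seams.

For the positive statement $N$ is chosen much larger than $n$. The graph of touching cells is then
so rich that boundedly many pairs of cells of a level can be joined by disjoint chains of touching
cells that avoid boundedly many forbidden cells (\<open>disjoint_chains\<close>). The reason is self-similarity:
a chain that has to change from one first-level copy to another one does so through a third copy
that nobody else uses; afterwards each copy faces a linking problem with no more pairs than before,
one level down. Now let $n$ points be given and fix a level at which cells around different points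
are disjoint. Each point has a home cell, and chains are asked for that lead from a neighbour of the
home of a point to a neighbour of the home of the next one. If the two points are on different
sheets, the chain is cut at a seam. There are enough seams: $n$ points need at most $n - 1 = m$
changes of sheet, and a point that is itself a seam may be counted on either sheet, so that it
saves the change that its absence from the list of available seams costs (\<open>few_side_changes\<close>).

A chain of cells contains a path along edges of these cells that meets further cells of the level at
most in its end points. Inside a home cell, two paths lead from the point to two different
corners; along the first only one coordinate is larger than that of the point, along the second only
another one, and this forces them to meet in the point alone (\<open>path_from_vertex\<close>, \<open>branches_meet\<close>).
So consecutive points are joined by connected strips, and two strips meet only where they have to
(\<open>strips_meet\<close>). In a Banach space every path contains an arc, and the arcs found in the strips
concatenate to the arc through the given points.
\<close>

section \<open>Vertices, halving maps and the gasket\<close>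

abbreviation coord :: "(real \<Rightarrow>\<^sub>C real) \<Rightarrow> nat \<Rightarrow> real" where
  "coord f i \<equiv> apply_bcontfun f (real i)"

text \<open>
Tent functions centred at the natural numbers are linearly independent vectors of a Banach space,
and evaluation at a natural number is the corresponding coordinate functional.
\<close>

definition vertex :: "nat \<Rightarrow> real \<Rightarrow>\<^sub>C real" where
  "vertex i = Bcontfun (\<lambda>x. max 0 (1 - \<bar>x - real i\<bar>))"

definition halfway :: "nat \<Rightarrow> (real \<Rightarrow>\<^sub>C real) \<Rightarrow> real \<Rightarrow>\<^sub>C real" where
  "halfway a f = (1/2) *\<^sub>R (f + vertex a)"

abbreviation contract :: "nat list \<Rightarrow> (real \<Rightarrow>\<^sub>C real) \<Rightarrow> real \<Rightarrow>\<^sub>C real" where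
  "contract \<equiv> foldr halfway"

text \<open>
Stage $L$ is the union of the images of the simplex under all words of length $L$. With the attractor
as the intersection of these decreasing compact sets, compactness is immediate, and a limit of points
of ever higher stages belongs to the attractor.
\<close>

primrec stage :: "nat \<Rightarrow> nat \<Rightarrow> (real \<Rightarrow>\<^sub>C real) set" where
  "stage N 0 = convex hull (vertex ` {..<N})"
| "stage N (Suc L) = (\<Union>a<N. halfway a ` stage N L)"

definition gasket :: "nat \<Rightarrow> (real \<Rightarrow>\<^sub>C real) set" where
  "gasket N = (\<Inter>L. stage N L)"

lemma coord_vertex: "coord (vertex i) k = (if k = i then 1 else 0)"
proof -
  have "(\<lambda>x. max 0 (1 - \<bar>x - real i\<bar>)) \<in> bcontfun"
    by (rule bcontfun_normI[of _ 1]) (auto intro!: continuous_intros)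
  then have "coord (vertex i) k = max 0 (1 - \<bar>real k - real i\<bar>)" by (simp add: vertex_def Bcontfun_inverse)
  then show ?thesis by auto
qed

lemma vertex_inject [simp]: "vertex i = vertex j \<longleftrightarrow> i = j"
  by (metis coord_vertex zero_neq_one)

lemma coord_halfway: "coord (halfway a f) k = (coord f k + (if k = a then 1 else 0)) / 2"
  by (simp add: halfway_def coord_vertex)

lemma halfway_inject [simp]: "halfway a f = halfway a g \<longleftrightarrow> f = g"
  by (simp add: halfway_def)

lemma halfway_vertex [simp]: "halfway a (vertex a) = vertex a"
  by (simp add: halfway_def scaleR_half_double)

lemma halfway_vertex_commute: "halfway a (vertex b) = halfway b (vertex a)"
  by (simp add: halfway_def add.commute)

lemma dist_halfway: "dist (halfway a f) (halfway a g) = dist f g / 2"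
  by (simp add: halfway_def dist_norm flip: scaleR_diff_right)

lemma continuous_on_halfway [continuous_intros]: "continuous_on S (halfway a)"
  unfolding halfway_def by (intro continuous_intros)

lemma continuous_on_contract: "continuous_on S (contract w)"
proof (induction w)
  case (Cons a w)
  then show ?case
    using continuous_on_compose[OF Cons.IH continuous_on_halfway] by simp
qed (simp add: id_def)

lemma inj_contract: "inj (contract w)"
  by (induction w) (auto simp: inj_def)

lemma funpow_halfway_vertex [simp]: "(halfway a ^^ k) (vertex a) = vertex a"
  by (induction k) auto

lemma dist_contract: "dist (contract w f) (contract w g) = dist f g / 2 ^ length w"
  by (induction w) (auto simp: dist_halfway)

lemma continuous_on_coordinate [continuous_intros]: "continuous_on S (\<lambda>f. coord f i)"
  unfolding continuous_on_iff
  by (metis dist_bounded le_less_trans)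

text \<open>
Barycentric coordinates: the three properties describe a convex set that contains the vertices.
\<close>

lemma simplex_coordinates:
  assumes "f \<in> stage N 0"
  shows "0 \<le> coord f i" "(\<Sum>k<N. coord f k) = 1" "f = (\<Sum>k<N. coord f k *\<^sub>R vertex k)"
proof -
  let ?C = "{f. (\<forall>i. 0 \<le> coord f i) \<and> (\<Sum>k<N. coord f k) = 1 \<and> f = (\<Sum>k<N. coord f k *\<^sub>R vertex k)}"
  have "convex ?C"
  proof (rule convexI)
    fix f g :: "real \<Rightarrow>\<^sub>C real" and u v :: real
    assume f: "f \<in> ?C" and g: "g \<in> ?C" and uv: "0 \<le> u" "0 \<le> v" "u + v = 1"
    define h where "h = u *\<^sub>R f + v *\<^sub>R g"
    have h: "coord h k = u * coord f k + v * coord g k" for k by (simp add: h_def)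
    have "h = u *\<^sub>R (\<Sum>k<N. coord f k *\<^sub>R vertex k) + v *\<^sub>R (\<Sum>k<N. coord g k *\<^sub>R vertex k)"
      unfolding h_def using f g by simp
    also have "\<dots> = (\<Sum>k<N. coord h k *\<^sub>R vertex k)"
      by (simp add: h scaleR_sum_right scaleR_add_left sum.distrib)
    finally have "h = (\<Sum>k<N. coord h k *\<^sub>R vertex k)" .
    moreover have "0 \<le> coord h k" for k using f g uv by (simp add: h)
    moreover have "(\<Sum>k<N. coord h k) = 1"
      using f g uv by (simp add: h sum.distrib flip: sum_distrib_left)
    ultimately show "u *\<^sub>R f + v *\<^sub>R g \<in> ?C" unfolding h_def[symmetric] by blast
  qed
  moreover have "vertex ` {..<N} \<subseteq> ?C"
    by (auto simp: coord_vertex if_distrib[of "\<lambda>c. c *\<^sub>R _"] cong: if_cong)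
  ultimately have "stage N 0 \<subseteq> ?C"
    by (simp add: hull_minimal)
  with assms show "0 \<le> coord f i" "(\<Sum>k<N. coord f k) = 1" "f = (\<Sum>k<N. coord f k *\<^sub>R vertex k)"
    by auto
qed

lemma stage_Suc_subset: "stage N (Suc L) \<subseteq> stage N L"
proof (induction L)
  case 0
  have "halfway a f \<in> stage N 0" if "a < N" "f \<in> stage N 0" for a f
  proof -
    have "vertex a \<in> stage N 0" using that by (simp add: hull_inc)
    then have "(1/2) *\<^sub>R f + (1/2) *\<^sub>R vertex a \<in> stage N 0"
      using that by (intro convexD) (auto simp: convex_convex_hull)
    then show ?thesis by (simp add: halfway_def scaleR_add_right)
  qed
  then show ?case by auto
next
  case (Suc L)
  then show ?case by fastforce
qed

lemma stage_antimono: "L \<le> M \<Longrightarrow> stage N M \<subseteq> stage N L"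
  by (rule lift_Suc_antimono_le[of "stage N"]) (rule stage_Suc_subset)

lemma compact_stage: "compact (stage N L)"
proof (induction L)
  case 0
  then show ?case by (simp add: finite_imp_compact_convex_hull)
next
  case (Suc L)
  then show ?case
    by (auto intro!: compact_UN compact_continuous_image continuous_on_halfway)
qed

lemma compact_gasket: "compact (gasket N)"
proof -
  have "closed (gasket N)"
    unfolding gasket_def by (intro closed_INT ballI compact_imp_closed compact_stage)
  moreover have "gasket N = stage N 0 \<inter> gasket N" by (auto simp: gasket_def simp del: stage.simps)
  ultimately show ?thesis by (metis compact_Int_closed compact_stage)
qed

lemma gasket_subset_simplex: "gasket N \<subseteq> stage N 0"
  unfolding gasket_def by blast

lemmas gasket_coordinates = simplex_coordinates[OF subsetD[OF gasket_subset_simplex]]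

text \<open>
For every $L$, a point of the intersection is the image of a point of stage $L$ under one of the
$N$ maps. One map occurs for infinitely many $L$; as it is injective and the stages decrease, the
same preimage works for all $L$.
\<close>

lemma gasket_self_similar: "gasket N = (\<Union>a<N. halfway a ` gasket N)"
proof (intro equalityI subsetI)
  fix f assume f: "f \<in> gasket N"
  have "\<forall>L. \<exists>a<N. f \<in> halfway a ` stage N L"
    using f by (metis (no_types, lifting) INT_E UNIV_I UN_E gasket_def lessThan_iff stage.simps(2))
  then obtain c where c: "c L < N" "f \<in> halfway (c L) ` stage N L" for L
    by metis
  have "finite (range c)" using c(1) by (auto intro: finite_subset[of _ "{..<N}"])
  then obtain a where a: "infinite {L. c L = a}"
    using pigeonhole_infinite[of UNIV c] by auto
  then obtain g where g: "f = halfway a g" using c(2) by (fastforce dest!: infinite_imp_nonempty)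
  have "g \<in> stage N L" for L
  proof -
    obtain M where "M \<ge> L" "c M = a"
      using a by (metis (mono_tags, lifting) infinite_nat_iff_unbounded_le mem_Collect_eq)
    then have "f \<in> halfway a ` stage N M" using c(2)[of M] by simp
    then have "g \<in> stage N M" using g by auto
    then show ?thesis using stage_antimono \<open>M \<ge> L\<close> by blast
  qed
  moreover have "a < N"
    using a c(1) by (fastforce dest!: infinite_imp_nonempty)
  ultimately show "f \<in> (\<Union>a<N. halfway a ` gasket N)"
    using g by (auto simp: gasket_def)
next
  fix f assume "f \<in> (\<Union>a<N. halfway a ` gasket N)"
  then obtain a g where g: "a < N" "g \<in> gasket N" "f = halfway a g" by auto
  then have "f \<in> stage N (Suc L)" for L by (auto simp: gasket_def)
  then have "f \<in> stage N L" for L using stage_Suc_subset by blast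
  then show "f \<in> gasket N" by (simp add: gasket_def)
qed

lemma halfway_in_gasket: "a < N \<Longrightarrow> f \<in> gasket N \<Longrightarrow> halfway a f \<in> gasket N"
  using gasket_self_similar by blast

text \<open>
The coordinates of both points add up to 1, so that domination forces equality. This is how paths
are shown to meet in one point only.
\<close>

lemma gasket_eqI:
  assumes "f \<in> gasket N" "g \<in> gasket N" "\<And>i. i < N \<Longrightarrow> coord f i \<le> coord g i"
  shows "f = g"
proof -
  have "(\<Sum>i<N. coord g i - coord f i) = 0"
    using gasket_coordinates(2) assms(1,2) by (simp add: sum_subtractf)
  then have "\<forall>i\<in>{..<N}. coord g i - coord f i = 0"
    by (subst (asm) sum_nonneg_eq_0_iff) (use assms in auto)
  then have "(\<Sum>k<N. coord f k *\<^sub>R vertex k) = (\<Sum>k<N. coord g k *\<^sub>R vertex k)"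
    by (intro sum.cong) auto
  then show ?thesis using gasket_coordinates(3) assms by metis
qed

text \<open>
Each half of the segment between two vertices is the image of the whole segment under one of the
two halving maps, so the segment survives in all stages.
\<close>

lemma gasket_edge: 
  assumes "a < N" "b < N"
  shows "closed_segment (vertex a) (vertex b) \<subseteq> gasket N"
proof -
  have "closed_segment (vertex a) (vertex b) \<subseteq> stage N L" for L
  proof (induction L)
    case 0
    show ?case using assms by (simp add: closed_segment_subset convex_convex_hull hull_inc)
  next
    case (Suc L)
    show ?case
    proof
      fix f assume "f \<in> closed_segment (vertex a) (vertex b)"
      then obtain t where t: "0 \<le> t" "t \<le> 1" "f = (1 - t) *\<^sub>R vertex a + t *\<^sub>R vertex b"
        by (auto simp: closed_segment_def)
      show "f \<in> stage N (Suc L)"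
      proof (cases "t \<le> 1/2")
        case True
        have "f = halfway a ((1 - 2*t) *\<^sub>R vertex a + (2*t) *\<^sub>R vertex b)"
          unfolding t(3) halfway_def by (simp add: scaleR_add_right scaleR_diff_right algebra_simps scaleR_half_double flip: scaleR_add_left)
        moreover have "(1 - 2*t) *\<^sub>R vertex a + (2*t) *\<^sub>R vertex b \<in> closed_segment (vertex a) (vertex b)"
          using True t by (auto simp: closed_segment_def)
        ultimately show ?thesis using Suc assms by auto
      next
        case False
        have "f = halfway b ((1 - (2*t-1)) *\<^sub>R vertex a + (2*t-1) *\<^sub>R vertex b)"
          unfolding t(3) halfway_def by (simp add: scaleR_add_right scaleR_diff_right algebra_simps scaleR_half_double flip: scaleR_add_left)
        moreover have "(1 - (2*t-1)) *\<^sub>R vertex a + (2*t-1) *\<^sub>R vertex b \<in> closed_segment (vertex a) (vertex b)"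
          using False t unfolding closed_segment_def by (intro CollectI exI[of _ "2*t-1"]) auto
        ultimately show ?thesis using Suc assms by auto
      qed
    qed
  qed
  then show ?thesis by (auto simp: gasket_def)
qed

lemma vertex_in_gasket: "a < N \<Longrightarrow> vertex a \<in> gasket N"
  using gasket_edge by (metis ends_in_segment(1) subsetD)

lemma gasket_vertexI: 
  assumes "f \<in> gasket N" "b < N" "1 \<le> coord f b"
  shows "f = vertex b"
proof -
  have "vertex b = f"
    by (rule gasket_eqI[of _ N]) (use assms gasket_coordinates(1) vertex_in_gasket in \<open>auto simp: coord_vertex\<close>)
  then show ?thesis by simp
qed

definition words :: "nat \<Rightarrow> nat \<Rightarrow> nat list set" where
  "words N L = {w. length w = L \<and> set w \<subseteq> {..<N}}"

lemma finite_words: "finite (words N L)"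
  using finite_lists_length_eq[of "{..<N}" L] by (simp add: words_def conj_commute)

definition cell :: "nat \<Rightarrow> nat list \<Rightarrow> (real \<Rightarrow>\<^sub>C real) set" where
  "cell N w = contract w ` gasket N"

lemma cell_Nil [simp]: "cell N [] = gasket N"
  by (simp add: cell_def)

lemma cell_Cons [simp]: "cell N (a # w) = halfway a ` cell N w"
  by (simp add: cell_def image_image)

lemma cell_subset_gasket: "w \<in> words N L \<Longrightarrow> cell N w \<subseteq> gasket N"
proof (induction w arbitrary: L)
  case (Cons a w)
  then have "w \<in> words N (length w)" "a < N" by (auto simp: words_def)
  with Cons.IH have "cell N w \<subseteq> gasket N" by blast
  with \<open>a < N\<close> show ?case by (auto intro: halfway_in_gasket)
qed simp

lemma cell_append_subset: "v \<in> words N L \<Longrightarrow> cell N (w @ v) \<subseteq> cell N w"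
  by (induction w) (use cell_subset_gasket in auto)

lemma compact_cell: "compact (cell N w)"
  unfolding cell_def by (intro compact_continuous_image continuous_on_contract compact_gasket)

lemma gasket_eq_Union_cells: "gasket N = (\<Union>w\<in>words N L. cell N w)"
proof (intro equalityI subsetI)
  fix f assume "f \<in> gasket N"
  then show "f \<in> (\<Union>w\<in>words N L. cell N w)"
  proof (induction L arbitrary: f)
    case 0
    then show ?case by (auto simp: words_def)
  next
    case (Suc L)
    obtain a g where g: "a < N" "g \<in> gasket N" "f = halfway a g" 
      using Suc.prems gasket_self_similar[of N] by blast
    obtain w where "w \<in> words N L" "g \<in> cell N w"
      using Suc.IH[OF g(2)] by auto
    with g have "a # w \<in> words N (Suc L)" "f \<in> cell N (a # w)" 
      by (auto simp: words_def)
    then show ?case by blast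
  qed
qed (use cell_subset_gasket in auto)

text \<open>
A vertex has a coordinate equal to 1. On the gasket, a halving map produces the coordinate 1 only at
its own index and only from 1.
\<close>

lemma vertex_in_cellD: "vertex b \<in> cell N w \<Longrightarrow> w \<in> words N L \<Longrightarrow> b < N \<Longrightarrow> w = replicate L b"
proof (induction w arbitrary: L)
  case Nil
  then show ?case by (simp add: words_def)
next
  case (Cons a w)
  then obtain g where g: "g \<in> cell N w" "vertex b = halfway a g" by auto
  have w: "w \<in> words N (length w)" "L = Suc (length w)" using Cons.prems by (auto simp: words_def)
  then have "g \<in> gasket N" using g cell_subset_gasket by blast
  have "coord (vertex b) b = coord (halfway a g) b" using g by simp
  then have 1: "coord g b + (if b = a then 1 else 0) = 2" by (simp add: coord_vertex coord_halfway)
  have "coord g b \<le> (\<Sum>i<N. coord g i)"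
    by (rule member_le_sum) (use \<open>b < N\<close> gasket_coordinates(1)[OF \<open>g \<in> gasket N\<close>] in auto)
  then have "coord g b \<le> 1" using gasket_coordinates(2)[OF \<open>g \<in> gasket N\<close>] by simp
  with 1 have "a = b" "coord g b = 1" by (auto split: if_splits)
  then have "g = vertex b" using gasket_vertexI \<open>g \<in> gasket N\<close> \<open>b < N\<close> by simp
  then have "w = replicate (length w) b" using Cons.IH w g \<open>b < N\<close> by blast
  then show ?case using \<open>a = b\<close> w(2) by simp
qed

text \<open>
A common point has two coordinates that are at least $1/2$, so it is the midpoint of two vertices.
\<close>

lemma halfway_Int_halfway:
  assumes "f \<in> gasket N" "g \<in> gasket N" "halfway a f = halfway b g" "a \<noteq> b" "a < N" "b < N"
  shows "f = vertex b" "g = vertex a"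
proof -
  have "coord (halfway a f) b = coord (halfway b g) b" "coord (halfway b g) a = coord (halfway a f) a"
    using assms(3) by auto
  then have "coord f b = coord g b + 1" "coord g a = coord f a + 1" using \<open>a \<noteq> b\<close> by (auto simp: coord_halfway)
  then have "coord f b \<ge> 1" "coord g a \<ge> 1" 
    using gasket_coordinates(1) assms(1,2) by (metis add.commute le_add_same_cancel1)+
  then show "f = vertex b" "g = vertex a" using gasket_vertexI assms by auto
qed

text \<open>
After the common prefix $p$ the two words continue in different first-level copies, which share
only the midpoint of the vertices $a$ and $b$. From there on the words must follow that midpoint,
which is vertex $b$ of the copy $a$ and vertex $a$ of the copy $b$.
\<close>

lemma cells_Int:
  assumes "f \<in> cell N w" "f \<in> cell N w'" "w \<in> words N L" "w' \<in> words N L" "w \<noteq> w'"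
  obtains p a b k where "a \<noteq> b" "w = p @ a # replicate k b" "w' = p @ b # replicate k a"
    "f = contract w (vertex b)" "a < N" "b < N"
proof -
  have "\<exists>p a b k. a \<noteq> b \<and> w = p @ a # replicate k b \<and> w' = p @ b # replicate k a
    \<and> f = contract w (vertex b) \<and> a < N \<and> b < N"
    using assms
  proof (induction w arbitrary: w' L f)
    case Nil
    then show ?case by (simp add: words_def)
  next
    case (Cons a v)
    then obtain b v' where w': "w' = b # v'" by (cases w') (auto simp: words_def)
    obtain g g' where g: "g \<in> cell N v" "f = halfway a g" "g' \<in> cell N v'" "f = halfway b g'"
      using Cons.prems w' by auto
    define M where "M = length v"
    have v: "v \<in> words N M" "v' \<in> words N M" "a < N" "b < N"
      using Cons.prems w' by (auto simp: words_def M_def)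
    show ?case
    proof (cases "a = b")
      case True
      then have "g = g'" "v \<noteq> v'" using g w' Cons.prems by auto
      then obtain p a' b' k where "a' \<noteq> b'" "v = p @ a' # replicate k b'" "v' = p @ b' # replicate k a'"
        "g = contract v (vertex b')" "a' < N" "b' < N"
        using Cons.IH[of g v' M] g v by blast
      then have "a' \<noteq> b' \<and> a # v = (a # p) @ a' # replicate k b' \<and> w' = (a # p) @ b' # replicate k a'
          \<and> f = contract (a # v) (vertex b') \<and> a' < N \<and> b' < N"
        using True w' g by simp
      then show ?thesis by blast
    next
      case False
      have "g \<in> gasket N" "g' \<in> gasket N" using g v cell_subset_gasket by blast+
      then have gv: "g = vertex b" "g' = vertex a"
        using halfway_Int_halfway g False v by auto
      then have "v = replicate M b" "v' = replicate M a"
        using g v vertex_in_cellD by blast+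
      then have "a \<noteq> b \<and> a # v = [] @ a # replicate M b \<and> w' = [] @ b # replicate M a
          \<and> f = contract (a # v) (vertex b) \<and> a < N \<and> b < N"
        using False w' g v gv by simp
      then show ?thesis by blast
    qed
  qed
  then show ?thesis using that by blast
qed

section \<open>Paths from a vertex\<close>

lemma dist_stage_bounded: obtains D where "\<And>f g. f \<in> stage N 0 \<Longrightarrow> g \<in> stage N 0 \<Longrightarrow> dist f g \<le> D" "0 \<le> D"
proof -
  have "bounded (stage N 0)" using compact_stage compact_imp_bounded by blast
  then obtain e where e: "\<forall>f\<in>stage N 0. \<forall>g\<in>stage N 0. dist f g \<le> e" 
    by (metis bounded_two_points)
  show ?thesis
  proof (rule that[of "max e 0"])
    show "dist f g \<le> max e 0" if "f \<in> stage N 0" "g \<in> stage N 0" for f g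
      using bspec[OF bspec[OF e that(1)] that(2)] by simp
  qed simp
qed

text \<open>
The path runs through the nested cells that contain $x$: in each of them it follows an edge, from
the corner with index $j$ of that cell to the corner with index $j$ of the next cell. Its
approximation \<open>\<gamma> L\<close> follows $L$ edges and then goes straight to $x$; since the rest of the path
takes place in a cell of level $L$, the approximations converge uniformly.

On the way only coordinate $j$ decreases and all others increase towards those of $x$. Recording
this bound is essential, because by \<open>gasket_eqI\<close> it keeps paths from different vertices apart.
\<close>

lemma path_from_vertex:
  assumes "j < N" "x \<in> gasket N"
  shows "path_component {f \<in> gasket N. \<forall>i. i \<noteq> j \<longrightarrow> coord f i \<le> coord x i} (vertex j) x"
proof -
  have "\<exists>a g. f \<in> gasket N \<longrightarrow> a < N \<and> g \<in> gasket N \<and> f = halfway a g" for f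
    using gasket_self_similar[of N] by blast
  then obtain d r where dr: "\<And>f. f \<in> gasket N \<Longrightarrow> d f < N \<and> r f \<in> gasket N \<and> f = halfway (d f) (r f)"
    by metis
  \<comment> \<open>\<open>d x\<close> and \<open>r x\<close> are the first letter of an address of $x$ and the point that it leaves.\<close>
  define \<gamma> where "\<gamma> = rec_nat (\<lambda>x. linepath (vertex j) x)
     (\<lambda>L G x. linepath (vertex j) (halfway (d x) (vertex j)) +++ (halfway (d x) \<circ> G (r x)))"
  have \<gamma>_0: "\<gamma> 0 x = linepath (vertex j) x" for x by (simp add: \<gamma>_def)
  have \<gamma>_Suc: "\<gamma> (Suc L) x = linepath (vertex j) (halfway (d x) (vertex j)) +++ (halfway (d x) \<circ> \<gamma> L (r x))"
    for L x by (simp add: \<gamma>_def)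
  have ends: "pathstart (\<gamma> L x) = vertex j \<and> pathfinish (\<gamma> L x) = x \<and> path (\<gamma> L x)"
    if "x \<in> gasket N" for L x
    using that
  proof (induction L arbitrary: x)
    case (Suc L)
    have IH: "pathstart (\<gamma> L (r x)) = vertex j" "pathfinish (\<gamma> L (r x)) = r x" "path (\<gamma> L (r x))"
      using Suc.IH dr[OF Suc.prems] by auto
    moreover have "path (halfway (d x) \<circ> \<gamma> L (r x))"
      using IH(3) by (intro path_continuous_image continuous_on_halfway)
    ultimately show ?case
      using dr[OF Suc.prems] by (auto simp: \<gamma>_Suc pathstart_compose pathfinish_compose)
  qed (auto simp: \<gamma>_0)
  have edge: "closed_segment (vertex j) (halfway a (vertex j)) \<subseteq> gasket N" if "a < N" for a
  proof -
    have "halfway a (vertex j) \<in> closed_segment (vertex j) (vertex a)"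
      unfolding closed_segment_def
      by (intro CollectI exI[of _ "1/2"]) (simp add: halfway_def scaleR_add_right)
    then have "closed_segment (vertex j) (halfway a (vertex j)) \<subseteq> closed_segment (vertex j) (vertex a)"
      by (simp add: subset_closed_segment)
    then show ?thesis using gasket_edge that assms(1) by blast
  qed
  have img: "path_image (\<gamma> L x) \<subseteq> {f \<in> stage N L. \<forall>i. i \<noteq> j \<longrightarrow> coord f i \<le> coord x i}" 
    if "x \<in> gasket N" for L x
    using that
  proof (induction L arbitrary: x)
    case 0
    have "closed_segment (vertex j) x \<subseteq> stage N 0"
      using 0 assms gasket_subset_simplex
      by (intro closed_segment_subset) (auto simp: convex_convex_hull hull_inc)
    moreover have "coord f i \<le> coord x i" if "f \<in> closed_segment (vertex j) x" "i \<noteq> j" for f i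
    proof -
      obtain u where "0 \<le> u" "u \<le> 1" "f = (1 - u) *\<^sub>R vertex j + u *\<^sub>R x"
        using \<open>f \<in> closed_segment (vertex j) x\<close> by (auto simp: closed_segment_def)
      then show ?thesis
        using \<open>i \<noteq> j\<close> gasket_coordinates(1)[OF 0] by (auto simp: coord_vertex mult_left_le_one_le)
    qed
    ultimately show ?case by (auto simp: \<gamma>_0 simp del: stage.simps)
  next
    case (Suc L)
    define a where "a = d x"
    have a: "a < N" "r x \<in> gasket N" "x = halfway a (r x)" using dr[OF Suc.prems] by (auto simp: a_def)
    have x: "coord x i = (coord (r x) i + (if i = a then 1 else 0)) / 2" for i
      using a(3) by (metis coord_halfway)
    have "coord f i \<le> coord x i" if "f \<in> closed_segment (vertex j) (halfway a (vertex j))" "i \<noteq> j" for f i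
    proof -
      obtain u where "0 \<le> u" "u \<le> 1" "f = (1 - u) *\<^sub>R vertex j + u *\<^sub>R halfway a (vertex j)"
        using \<open>f \<in> _\<close> by (auto simp: closed_segment_def)
      then show ?thesis
        using \<open>i \<noteq> j\<close> gasket_coordinates(1)[OF a(2), of i] by (auto simp: coord_vertex coord_halfway x)
    qed
    moreover have "closed_segment (vertex j) (halfway a (vertex j)) \<subseteq> stage N (Suc L)"
      using edge[OF a(1)] by (auto simp: gasket_def simp del: stage.simps)
    moreover have "coord (halfway a f) i \<le> coord x i" if "f \<in> path_image (\<gamma> L (r x))" "i \<noteq> j" for f i
      using Suc.IH[OF a(2)] that by (auto simp: coord_halfway x divide_right_mono)
    moreover have "halfway a f \<in> stage N (Suc L)" if "f \<in> path_image (\<gamma> L (r x))" for f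
      using Suc.IH[OF a(2)] that a(1) by auto
    moreover have "path_image (\<gamma> (Suc L) x) \<subseteq> closed_segment (vertex j) (halfway a (vertex j))
        \<union> halfway a ` path_image (\<gamma> L (r x))"
      unfolding \<gamma>_Suc a_def[symmetric] using path_image_join_subset 
      by (metis path_image_compose path_image_linepath)
    ultimately show ?case by (auto simp del: stage.simps)
  qed
  have in0: "\<gamma> L x t \<in> stage N 0" if "x \<in> gasket N" "t \<in> {0..1}" for L x t
  proof -
    have "\<gamma> L x t \<in> path_image (\<gamma> L x)" using that by (simp add: path_image_def)
    then show ?thesis using img[OF that(1), of L] stage_antimono[of 0 L N] by blast
  qed
  obtain D where D: "\<And>f g. f \<in> stage N 0 \<Longrightarrow> g \<in> stage N 0 \<Longrightarrow> dist f g \<le> D" "0 \<le> D"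
    using dist_stage_bounded by blast
  have step: "dist (\<gamma> (Suc L) x t) (\<gamma> L x t) \<le> D / 2 ^ L" if "x \<in> gasket N" "t \<in> {0..1}" for L x t
    using that
  proof (induction L arbitrary: x t)
    case 0
    then show ?case using D(1)[OF in0 in0] by simp
  next
    case (Suc L)
    show ?case
    proof (cases "t \<le> 1/2")
      case True
      then show ?thesis using D(2) by (simp add: \<gamma>_Suc[of "Suc L"] \<gamma>_Suc[of L] joinpaths_def)
    next
      case False
      then have "dist (\<gamma> (Suc (Suc L)) x t) (\<gamma> (Suc L) x t) 
        = dist (\<gamma> (Suc L) (r x) (2*t-1)) (\<gamma> L (r x) (2*t-1)) / 2"
        by (simp add: \<gamma>_Suc[of "Suc L" x] \<gamma>_Suc[of L x] joinpaths_def dist_halfway)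
      also have "\<dots> \<le> (D / 2 ^ L) / 2"
        using Suc.IH[of "r x" "2*t-1"] dr[OF Suc.prems(1)] Suc.prems(2) False by auto
      finally show ?thesis by simp
    qed
  qed
  have Cauchy: "dist (\<gamma> m x t) (\<gamma> (m + k) x t) \<le> 2 * D / 2 ^ m - 2 * D / 2 ^ (m + k)"
    if "t \<in> {0..1}" for m k t
  proof (induction k)
    case (Suc k)
    have "dist (\<gamma> m x t) (\<gamma> (m + Suc k) x t) 
      \<le> dist (\<gamma> m x t) (\<gamma> (m + k) x t) + dist (\<gamma> (Suc (m + k)) x t) (\<gamma> (m + k) x t)"
      by (metis add_Suc_right dist_triangle2)
    also have "\<dots> \<le> 2 * D / 2 ^ m - 2 * D / 2 ^ (m + k) + D / 2 ^ (m + k)"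
      using Suc.IH step[OF assms(2) that] by (rule add_mono)
    also have "\<dots> = 2 * D / 2 ^ m - 2 * D / 2 ^ (m + Suc k)" by simp
    finally show ?case .
  qed simp
  have "uniformly_Cauchy_on {0..1} (\<lambda>n. \<gamma> n x)"
  proof (rule uniformly_Cauchy_onI')
    fix e :: real assume "0 < e"
    then obtain M where M: "2 * D * (1/2) ^ M < e"
      using LIMSEQ_D[OF tendsto_mult_right_zero[OF LIMSEQ_realpow_zero[of "1/2"]], of e "2 * D"] D(2) by auto
    show "\<exists>M. \<forall>t\<in>{0..1}. \<forall>m\<ge>M. \<forall>n>m. dist (\<gamma> m x t) (\<gamma> n x t) < e"
    proof (intro exI[of _ M] ballI allI impI)
      fix t :: real and m n assume t: "t \<in> {0..1}" and "M \<le> m" "m < n"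
      have "dist (\<gamma> m x t) (\<gamma> n x t) \<le> 2 * D / 2 ^ m"
        using Cauchy[OF t, of m "n - m"] \<open>m < n\<close> D(2)
        by (auto intro: order_trans)
      also have "\<dots> \<le> 2 * D / 2 ^ M"
        using \<open>M \<le> m\<close> D(2) by (simp add: frac_le power_increasing)
      also have "\<dots> < e" using M by (simp add: power_one_over)
      finally show "dist (\<gamma> m x t) (\<gamma> n x t) < e" .
    qed
  qed
  from Cauchy_uniformly_convergent[OF this]
  obtain \<delta> where lim: "uniform_limit {0..1} (\<lambda>n. \<gamma> n x) \<delta> sequentially"
    unfolding uniformly_convergent_on_def by blast
  have "continuous_on {0..1} \<delta>"
    by (rule uniform_limit_theorem[OF _ lim])
      (use ends[OF assms(2)] in \<open>auto simp: path_def\<close>)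
  then have "path \<delta>" by (simp add: path_def)
  have ptw: "(\<lambda>n. \<gamma> n x t) \<longlonglongrightarrow> \<delta> t" if "t \<in> {0..1}" for t
    using tendsto_uniform_limitI[OF lim that] .
  have "\<delta> 0 = vertex j" 
    using ptw[of 0] ends[OF assms(2)] by (simp add: pathstart_def LIMSEQ_const_iff)
  moreover have "\<delta> 1 = x" 
    using ptw[of 1] ends[OF assms(2)] by (simp add: pathfinish_def LIMSEQ_const_iff)
  moreover have "\<delta> t \<in> {f \<in> gasket N. \<forall>i. i \<noteq> j \<longrightarrow> coord f i \<le> coord x i}" if t: "t \<in> {0..1}" for t
  proof -
    have in_img: "\<gamma> n x t \<in> path_image (\<gamma> n x)" for n using t by (simp add: path_image_def)
    have "\<delta> t \<in> stage N L" for L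
    proof (rule Lim_in_closed_set[OF _ _ _ ptw[OF t]])
      show "closed (stage N L)" using compact_stage compact_imp_closed by blast
      show "\<forall>\<^sub>F n in sequentially. \<gamma> n x t \<in> stage N L"
        using in_img img[OF assms(2)] stage_antimono unfolding eventually_sequentially by blast
    qed simp
    moreover have "coord (\<delta> t) i \<le> coord x i" if "i \<noteq> j" for i
    proof -
      have "\<delta> t \<in> {f. coord f i \<le> coord x i}"
      proof (rule Lim_in_closed_set[OF _ _ _ ptw[OF t]])
        show "closed {f. coord f i \<le> coord x i}"
          by (intro closed_Collect_le continuous_intros)
        show "\<forall>\<^sub>F n in sequentially. \<gamma> n x t \<in> {f. coord f i \<le> coord x i}"
          using in_img img[OF assms(2)] that by (intro always_eventually) blast
      qed simp
      then show ?thesis by simp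
    qed
    ultimately show ?thesis by (auto simp: gasket_def)
  qed
  ultimately show ?thesis
    using \<open>path \<delta>\<close> unfolding path_component_def 
    by (intro exI[of _ \<delta>]) (auto simp: path_image_def pathstart_def pathfinish_def)
qed

section \<open>Chains of touching cells\<close>

text \<open>
Inside cell $p$ the copies $a$ and $b$ share a point, which is the corner $b$ of the first and the
corner $a$ of the second; the trailing letters lead to this corner on a finer level. By \<open>cells_Int\<close>
no other pairs of cells of equal level meet.
\<close>

definition touching :: "nat list \<Rightarrow> nat list \<Rightarrow> bool" where
  "touching w w' \<longleftrightarrow> (\<exists>p a b k. a \<noteq> b \<and> w = p @ a # replicate k b \<and> w' = p @ b # replicate k a)"

lemma touching_Cons: "touching w w' \<Longrightarrow> touching (c # w) (c # w')"
  unfolding touching_def by (metis append_Cons)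

lemma touching_start: "a \<noteq> b \<Longrightarrow> touching (a # replicate k b) (b # replicate k a)"
  unfolding touching_def by (metis append_Nil)

definition chain :: "nat list set \<Rightarrow> nat list \<Rightarrow> nat list \<Rightarrow> nat list list \<Rightarrow> bool" where
  "chain S v w P \<longleftrightarrow> P \<noteq> [] \<and> hd P = v \<and> last P = w \<and> successively touching P \<and> set P \<subseteq> S"

lemma chain_map_Cons: "chain S v w P \<Longrightarrow> chain ((#) c ` S) (c # v) (c # w) (map ((#) c) P)"
  by (auto simp: chain_def hd_map last_map successively_map intro: successively_mono touching_Cons)

lemma chain_append:
  "chain S v w P \<Longrightarrow> touching w w' \<Longrightarrow> chain S w' z Q \<Longrightarrow> chain S v z (P @ Q)"
  by (auto simp: chain_def successively_append_iff)

lemma chain_mono: "chain S v w P \<Longrightarrow> S \<subseteq> T \<Longrightarrow> chain T v w P"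
  by (auto simp: chain_def)

lemma word_Suc_cases:
  assumes "w \<in> words N (Suc L)"
  shows "w = hd w # tl w" "hd w < N" "tl w \<in> words N L" "last w < N"
proof -
  obtain a v where w: "w = a # v" using assms by (cases w) (auto simp: words_def)
  show "w = hd w # tl w" "hd w < N" "tl w \<in> words N L" using assms w by (auto simp: words_def)
  have "last w \<in> set w" using w by simp
  then show "last w < N" using assms by (auto simp: words_def)
qed

text \<open>
Linking in the graph of touching words of length $L + 1$: pair number $i$ has the ends \<open>T i False\<close>
and \<open>T i True\<close>, and $Z$ is forbidden.

In the induction step, a pair whose ends have the same first letter stays in this copy. A pair that
has to cross from copy $a$ to copy $b$ goes through a copy $z_i$ chosen for it alone: it leaves $a$
at the corner $z_i$, traverses $z_i$ between its corners $a$ and $b$, and enters $b$ at the corner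
$z_i$. If $z_i$ is neither the first nor the last letter of an end or of a forbidden word, then the
new ends in the copies differ from all old ones and are not forbidden: a corner $z_i$ is a word that
consists of $z_i$ only, hence ends in $z_i$, and the words of copy $z_i$ begin with $z_i$. The number of pairs in one copy is at most the number
of all pairs, so the same bound on $N$ serves on all levels.
\<close>

lemma disjoint_chains:
  fixes T :: "nat \<Rightarrow> bool \<Rightarrow> nat list"
  assumes "finite I" "finite Z" "5 * card I + 2 * card Z \<le> N"
    and "\<And>i s. i \<in> I \<Longrightarrow> T i s \<in> words N (Suc L) - Z"
    and "inj_on (\<lambda>(i, s). T i s) (I \<times> UNIV)"
  shows "\<exists>P. (\<forall>i\<in>I. chain (words N (Suc L) - Z) (T i False) (T i True) (P i)) \<and>
             (\<forall>i\<in>I. \<forall>k\<in>I. i \<noteq> k \<longrightarrow> set (P i) \<inter> set (P k) = {})"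
  using assms
proof (induction L arbitrary: I T Z)
  case 0
  have inj: "T i s = T k t \<longleftrightarrow> i = k \<and> s = t" if "i \<in> I" "k \<in> I" for i k s t
    using 0(5) that by (auto simp: inj_on_def)
  show ?case
  proof (intro exI[of _ "\<lambda>i. [T i False, T i True]"] conjI ballI impI)
    fix i assume i: "i \<in> I"
    have "\<exists>a. T i s = [a]" for s
      using 0(4)[OF i, of s] by (auto simp: words_def length_Suc_conv)
    then obtain a b where ab: "T i False = [a]" "T i True = [b]" by metis
    then have "a \<noteq> b" using inj[of i i False True] i by auto
    then have "touching [a] [b]" using touching_start[of a b 0] by simp
    then show "chain (words N (Suc 0) - Z) (T i False) (T i True) [T i False, T i True]"
      using ab 0(4)[OF i, of False] 0(4)[OF i, of True] by (simp add: chain_def)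
  qed (use inj in auto)
next
  case (Suc L)
  have T: "hd (T i s) # tl (T i s) = T i s" "hd (T i s) < N" "tl (T i s) \<in> words N (Suc L)"
     "last (T i s) < N" "T i s \<notin> Z"
    if "i \<in> I" for i s
    using Suc.prems(4)[OF that, of s] word_Suc_cases[of "T i s" N "Suc L"] by auto
  have inj: "T i s = T k t \<longleftrightarrow> i = k \<and> s = t" if "i \<in> I" "k \<in> I" for i k s t
    using Suc.prems(5) that by (auto simp: inj_on_def)
  \<comment> \<open>The letters through which no crossing pair may be routed.\<close>
  define B where "B = (\<lambda>(i, s). T i s) ` (I \<times> UNIV) \<union> Z"
  define Bad where "Bad = hd ` B \<union> last ` B"
  have "finite B" using Suc.prems by (simp add: B_def)
  have "card B \<le> 2 * card I + card Z"
  proof -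
    have "card ((\<lambda>(i, s). T i s) ` (I \<times> (UNIV::bool set))) \<le> card (I \<times> (UNIV::bool set))"
      using Suc.prems by (intro card_image_le) auto
    also have "\<dots> = 2 * card I" by (simp add: card_cartesian_product)
    finally show ?thesis unfolding B_def using card_Un_le le_trans add_mono by (metis order_refl)
  qed
  moreover have "card Bad \<le> card B + card B"
    unfolding Bad_def using card_image_le[OF \<open>finite B\<close>] card_Un_le add_mono le_trans by metis
  ultimately have "card Bad \<le> 4 * card I + 2 * card Z" by linarith
  moreover have "finite Bad" using \<open>finite B\<close> by (simp add: Bad_def)
  ultimately have "card I \<le> card ({..<N} - Bad)"
    using Suc.prems(3) diff_card_le_card_Diff[OF \<open>finite Bad\<close>, of "{..<N}"] by simp
  then obtain z where z: "inj_on z I" "z ` I \<subseteq> {..<N} - Bad"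
    using card_le_inj[OF \<open>finite I\<close>, of "{..<N} - Bad"] by auto
  have zN: "z i < N" "z i \<notin> Bad" if "i \<in> I" for i using z that by auto
  have z_inj: "z i = z k \<Longrightarrow> i = k" if "i \<in> I" "k \<in> I" for i k using z that by (auto dest: inj_onD)
  have hd_Bad: "hd (T i s) \<in> Bad" and last_Bad: "last (T i s) \<in> Bad" if "i \<in> I" for i s
    unfolding Bad_def B_def using that by force+
  have Z_Bad: "hd w \<in> Bad" "last w \<in> Bad" if "w \<in> Z" for w
    unfolding Bad_def B_def using that by auto
  define cross where "cross i \<longleftrightarrow> hd (T i False) \<noteq> hd (T i True)" for i
  \<comment> \<open>\<open>J c\<close> is the set of pairs whose chain visits copy $c$, and \<open>U c i\<close> are the ends of its part there.\<close>
  define J where "J c = {i\<in>I. c = hd (T i False) \<or> c = hd (T i True) \<or> (cross i \<and> c = z i)}" for c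
  define U where "U c i s = (if c = hd (T i s) then tl (T i s) 
      else if c = z i then replicate (Suc L) (hd (T i s)) else replicate (Suc L) (z i))" for c i s
  have cross_iff: "cross i \<longleftrightarrow> hd (T i s) \<noteq> hd (T i (\<not> s))" for i s
    by (cases s) (auto simp: cross_def)
  have "\<exists>P. (\<forall>i\<in>J c. chain (words N (Suc L) - {w. c # w \<in> Z}) (U c i False) (U c i True) (P i)) \<and>
             (\<forall>i\<in>J c. \<forall>k\<in>J c. i \<noteq> k \<longrightarrow> set (P i) \<inter> set (P k) = {})" if "c < N" for c
  proof (rule Suc.IH)
    have "J c \<subseteq> I" by (auto simp: J_def)
    then show "finite (J c)" using Suc.prems finite_subset by blast
    have Zc: "(#) c ` {w. c # w \<in> Z} \<subseteq> Z" by auto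
    have "finite ((#) c ` {w. c # w \<in> Z})" using Zc Suc.prems(2) finite_subset by blast
    then show finZ: "finite {w. c # w \<in> Z}" by (rule finite_imageD) (auto simp: inj_on_def)
    have "card {w. c # w \<in> Z} = card ((#) c ` {w. c # w \<in> Z})" by (simp add: card_image)
    also have "\<dots> \<le> card Z" by (rule card_mono[OF Suc.prems(2) Zc])
    finally show "5 * card (J c) + 2 * card {w. c # w \<in> Z} \<le> N"
      using card_mono[OF Suc.prems(1) \<open>J c \<subseteq> I\<close>] Suc.prems(3) by linarith
  next
    fix i s assume i: "i \<in> J c"
    then have iI: "i \<in> I" by (simp add: J_def)
    have "U c i s \<in> words N (Suc L)"
      using T[OF iI, of s] zN[OF iI] by (auto simp: U_def words_def)
    moreover have "c # U c i s \<notin> Z"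
    proof (cases "c = hd (T i s)")
      case True
      then show ?thesis using T[OF iI, of s] by (simp add: U_def)
    next
      case False
      show ?thesis
      proof
        assume *: "c # U c i s \<in> Z"
        show False
        proof (cases "c = z i")
          case True
          then show False using Z_Bad(1)[OF *] zN[OF iI] by simp
        next
          case cz: False
          then have "c # U c i s = c # replicate (Suc L) (z i)" using False by (simp add: U_def)
          then have "last (c # U c i s) = z i" by (metis last_ConsR last_replicate list.distinct(1) nat.distinct(1) replicate_Suc)
          then show False using Z_Bad(2)[OF *] zN[OF iI] by simp
        qed
      qed
    qed
    ultimately show "U c i s \<in> words N (Suc L) - {w. c # w \<in> Z}" by simp
  next
    have eqD: "i = k \<and> s = t" if ik: "i \<in> J c" "k \<in> J c" and eq: "U c i s = U c k t" for i k s t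
    proof -
      have I: "i \<in> I" "k \<in> I" using ik by (auto simp: J_def)
      have tl_last: "tl (T i s) \<noteq> replicate (Suc L) (z k)" if "i \<in> I" "k \<in> I" for i k s
      proof
        assume "tl (T i s) = replicate (Suc L) (z k)"
        then have "last (T i s) = z k" 
          using T(1)[OF that(1), of s] by (metis last_ConsR last_replicate list.distinct(1) nat.distinct(1) replicate_Suc)
        then show False using last_Bad[OF that(1), of s] zN(2)[OF that(2)] by simp
      qed
      have rep: "replicate (Suc L) a = replicate (Suc L) b \<longleftrightarrow> a = b" for a b :: nat by auto
      have same: "c = hd (T i s) \<or> c = hd (T i t) \<or> s = t \<or> c = z i"
        using ik(1) cross_iff[of i s] cross_iff[of i t] by (cases s; cases t) (auto simp: J_def)
      consider (tt) "c = hd (T i s)" "c = hd (T k t)"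
        | (tz) "c = hd (T i s)" "c \<noteq> hd (T k t)"
        | (zt) "c \<noteq> hd (T i s)" "c = hd (T k t)"
        | (zz) "c \<noteq> hd (T i s)" "c \<noteq> hd (T k t)" by blast
      then show ?thesis
      proof cases
        case tt
        then have "tl (T i s) = tl (T k t)" using eq by (simp add: U_def)
        then have "T i s = T k t" using tt T(1)[OF I(1), of s] T(1)[OF I(2), of t] by metis
        then show ?thesis using inj[OF I] by simp
      next
        case tz
        then have "c \<noteq> z k" using hd_Bad[OF I(1), of s] zN(2)[OF I(2)] by auto
        then show ?thesis using tz eq tl_last[OF I] by (simp add: U_def)
      next
        case zt
        then have "c \<noteq> z i" using hd_Bad[OF I(2), of t] zN(2)[OF I(1)] by auto
        then show ?thesis using zt eq tl_last[OF I(2,1), of t] by (simp add: U_def)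
      next
        case zz
        show ?thesis
        proof (cases "c = z i")
          case True
          show ?thesis
          proof (cases "c = z k")
            case True
            then have "i = k" using z_inj I \<open>c = z i\<close> by simp
            moreover have "hd (T i s) = hd (T i t)" using eq zz True \<open>c = z i\<close> \<open>i = k\<close> by (simp add: U_def)
            moreover have "cross i" using ik(1) zN(2)[OF I(1)] hd_Bad[OF I(1)] True \<open>c = z i\<close> 
              by (auto simp: J_def)
            ultimately show ?thesis using cross_iff[of i s] by (cases s; cases t) auto
          next
            case False
            then have "hd (T i s) = z k" using eq zz \<open>c = z i\<close> by (simp add: U_def)
            then show ?thesis using hd_Bad[OF I(1), of s] zN(2)[OF I(2)] by simp
          qed
        next
          case False
          show ?thesis
          proof (cases "c = z k")
            case True
            then have "hd (T k t) = z i" using eq zz False by (simp add: U_def)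
            then show ?thesis using hd_Bad[OF I(2), of t] zN(2)[OF I(1)] by simp
          next
            case F2: False
            then have "i = k" using eq zz False z_inj I by (simp add: U_def)
            then show ?thesis using same zz False by auto
          qed
        qed
      qed
    qed
    show "inj_on (\<lambda>(i, s). U c i s) (J c \<times> UNIV)"
      unfolding inj_on_def using eqD by auto
  qed
  then obtain Q where Q: "\<And>c i. c < N \<Longrightarrow> i \<in> J c \<Longrightarrow> 
        chain (words N (Suc L) - {w. c # w \<in> Z}) (U c i False) (U c i True) (Q c i)"
    and Q_disj: "\<And>c i k. c < N \<Longrightarrow> i \<in> J c \<Longrightarrow> k \<in> J c \<Longrightarrow> i \<noteq> k \<Longrightarrow> set (Q c i) \<inter> set (Q c k) = {}"
    by metis
  define R where "R c i = map ((#) c) (Q c i)" for c i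
  have R: "chain (words N (Suc (Suc L)) - Z) (c # U c i False) (c # U c i True) (R c i)"
    if "c < N" "i \<in> J c" for c i
    unfolding R_def
    by (rule chain_mono[OF chain_map_Cons[OF Q[OF that]]]) (use that in \<open>auto simp: words_def\<close>)
  define P where "P i = (if cross i then R (hd (T i False)) i @ R (z i) i @ R (hd (T i True)) i
     else R (hd (T i False)) i)" for i
  have J: "hd (T i s) \<in> {..<N}" "i \<in> J (hd (T i s))" "cross i \<Longrightarrow> i \<in> J (z i)" if "i \<in> I" for i s
    using that T(2) by (cases s; auto simp: J_def)+
  show ?case
  proof (intro exI[of _ P] conjI ballI impI)
    fix i assume i: "i \<in> I"
    define a b where "a = hd (T i False)" and "b = hd (T i True)"
    have z_ne: "z i \<noteq> hd (T i s)" for s using zN(2)[OF i] hd_Bad[OF i, of s] by auto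
    show "chain (words N (Suc (Suc L)) - Z) (T i False) (T i True) (P i)"
    proof (cases "cross i")
      case True
      then have "a \<noteq> b" by (simp add: cross_def a_def b_def)
      have U: "U a i False = tl (T i False)" "U a i True = replicate (Suc L) (z i)"
         "U (z i) i False = replicate (Suc L) a" "U (z i) i True = replicate (Suc L) b"
         "U b i False = replicate (Suc L) (z i)" "U b i True = tl (T i True)"
        using \<open>a \<noteq> b\<close> z_ne[of False] z_ne[of True] by (auto simp: U_def a_def b_def)
      have 1: "chain (words N (Suc (Suc L)) - Z) (T i False) (a # replicate (Suc L) (z i)) (R a i)"
        using R[of a i] J(1,2)[OF i, of False] T(1)[OF i, of False] U by (simp add: a_def)
      have 2: "chain (words N (Suc (Suc L)) - Z) (z i # replicate (Suc L) a) (z i # replicate (Suc L) b) (R (z i) i)"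
        using R[of "z i" i] J(3)[OF i True] zN(1)[OF i] U by simp
      have 3: "chain (words N (Suc (Suc L)) - Z) (b # replicate (Suc L) (z i)) (T i True) (R b i)"
        using R[of b i] J(1,2)[OF i, of True] T(1)[OF i, of True] U by (simp add: b_def)
      have t: "touching (a # replicate (Suc L) (z i)) (z i # replicate (Suc L) a)"
        "touching (z i # replicate (Suc L) b) (b # replicate (Suc L) (z i))"
        by (rule touching_start; use z_ne a_def b_def in metis)+
      show ?thesis 
        using chain_append[OF 1 t(1) chain_append[OF 2 t(2) 3]] True by (simp add: P_def a_def b_def)
    next
      case False
      then have "a = b" by (simp add: cross_def a_def b_def)
      then have "U a i False = tl (T i False)" "U a i True = tl (T i True)"
        by (auto simp: U_def a_def b_def)
      then show ?thesis
        using R[of a i] J(1,2)[OF i, of False] T(1)[OF i, of False] T(1)[OF i, of True] \<open>a = b\<close> False 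
        by (simp add: P_def a_def b_def)
    qed
  next
    fix i k assume ik: "i \<in> I" "k \<in> I" "i \<noteq> k"
    have P_in: "\<exists>c w. c < N \<and> i \<in> J c \<and> v = c # w \<and> w \<in> set (Q c i)" if "i \<in> I" "v \<in> set (P i)" for i v
      using that J(1,2)[OF that(1), of False] J(1,2)[OF that(1), of True] zN(1)[OF that(1)] J(3)[OF that(1)]
      unfolding P_def R_def by (auto split: if_splits)
    show "set (P i) \<inter> set (P k) = {}"
    proof (rule ccontr)
      assume "set (P i) \<inter> set (P k) \<noteq> {}"
      then obtain v where "v \<in> set (P i)" "v \<in> set (P k)" by auto
      with P_in ik obtain c w where "c < N" "i \<in> J c" "k \<in> J c" "w \<in> set (Q c i)" "w \<in> set (Q c k)"
        by (metis list.inject)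
      then show False using Q_disj ik by blast
    qed
  qed
qed

section \<open>Paths and arcs\<close>

lemma path_component_image:
  assumes "path_component S a b" "continuous_on S f"
  shows "path_component (f ` S) (f a) (f b)"
proof -
  obtain g where g: "path g" "path_image g \<subseteq> S" "pathstart g = a" "pathfinish g = b"
    using assms(1) by (auto simp: path_component_def)
  have "path (f \<circ> g)"
    using g assms(2) by (intro path_continuous_image) (auto intro: continuous_on_subset)
  then show ?thesis
    using g unfolding path_component_def
    by (intro exI[of _ "f \<circ> g"]) (auto simp: path_image_compose pathstart_compose pathfinish_compose)
qed

text \<open>
The last clause \<open>t n = 1\<close> is for the induction, where the next arc is attached at the end of the
parameter interval.
\<close>

lemma concatenate_arcs:
  fixes x :: "nat \<Rightarrow> 'a::topological_space" and H :: "nat \<Rightarrow> real \<Rightarrow> 'a"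
  assumes "2 \<le> n"
    and "\<And>i. i \<in> {1..<n} \<Longrightarrow> arc (H i) \<and> pathstart (H i) = x i \<and> pathfinish (H i) = x (Suc i)"
    and "\<And>i k. i \<in> {1..<n} \<Longrightarrow> k \<in> {1..<n} \<Longrightarrow> i < k \<Longrightarrow>
      path_image (H i) \<inter> path_image (H k) \<subseteq> (if k = Suc i then {x k} else {})"
  shows "\<exists>g t. arc g \<and> path_image g \<subseteq> (\<Union>i\<in>{1..<n}. path_image (H i)) \<and> 
    t \<in> {1..n} \<rightarrow> {0..1} \<and> strict_mono_on {1..n} t \<and> (\<forall>i\<in>{1..n}. g (t i) = x i) \<and> t n = (1::real)"
  using assms
proof (induction n rule: nat_induct_at_least)
  case base
  then have "arc (H 1)" "H 1 0 = x 1" "H 1 1 = x 2"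
    by (auto simp: pathstart_def pathfinish_def numeral_2_eq_2)
  moreover have "{1..2} = {1, 2::nat}" "{1..<2} = {1::nat}" by auto
  ultimately show ?case
    by (intro exI[of _ "H 1"] exI[of _ "\<lambda>i. real i - 1"]) (auto simp: strict_mono_on_def)
next
  case (Suc n)
  obtain g t where g: "arc g" "path_image g \<subseteq> (\<Union>i\<in>{1..<n}. path_image (H i))"
    and t: "t \<in> {1..n} \<rightarrow> {0..1}" "strict_mono_on {1..n} t" "\<And>i. i \<in> {1..n} \<Longrightarrow> g (t i) = x i" "t n = 1"
    using Suc.IH Suc.prems by (metis atLeastLessThan_iff less_SucI)
  have Hn: "arc (H n)" "pathstart (H n) = x n" "pathfinish (H n) = x (Suc n)"
    using Suc.prems(1)[of n] Suc.hyps by auto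
  have gn: "pathfinish g = x n" using t(3)[of n] t(4) Suc.hyps by (simp add: pathfinish_def)
  have "path_image (H i) \<inter> path_image (H n) \<subseteq> {x n}" if "i \<in> {1..<n}" for i
    using Suc.prems(2)[of i n] that Suc.hyps by (auto split: if_splits)
  then have "(\<Union>i\<in>{1..<n}. path_image (H i)) \<inter> path_image (H n) \<subseteq> {x n}" by blast
  then have "path_image g \<inter> path_image (H n) \<subseteq> {pathstart (H n)}"
    unfolding Hn(2) using g(2) by (meson Int_mono order_refl order_trans)
  then have arc: "arc (g +++ H n)" using g Hn gn by (intro arc_join) auto
  define t' where "t' i = (if i \<le> n then t i / 2 else 1)" for i
  have t01: "0 \<le> t i" "t i \<le> 1" if "i \<in> {1..n}" for i using t(1) that by (auto simp: Pi_iff)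
  show ?case
  proof (intro exI[of _ "g +++ H n"] exI[of _ t'] conjI arc)
    show "path_image (g +++ H n) \<subseteq> (\<Union>i\<in>{1..<Suc n}. path_image (H i))"
      using path_image_join_subset[of g "H n"] g(2) Suc.hyps by fastforce
    have "t' i \<in> {0..1}" if "i \<in> {1..Suc n}" for i
      using t01[of i] that by (auto simp: t'_def)
    then show "t' \<in> {1..Suc n} \<rightarrow> {0..1}" by blast
    show "strict_mono_on {1..Suc n} t'"
    proof (rule strict_mono_onI)
      fix i k assume ik: "i \<in> {1..Suc n}" "k \<in> {1..Suc n}" "i < k"
      show "t' i < t' k"
      proof (cases "k \<le> n")
        case True
        then show ?thesis using ik strict_mono_onD[OF t(2), of i k] by (simp add: t'_def)
      next
        case False
        then show ?thesis using ik t01(2)[of i] by (simp add: t'_def)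
      qed
    qed
    show "\<forall>i\<in>{1..Suc n}. (g +++ H n) (t' i) = x i"
    proof
      fix i assume i: "i \<in> {1..Suc n}"
      show "(g +++ H n) (t' i) = x i"
      proof (cases "i \<le> n")
        case True
        then show ?thesis using t(3)[of i] t01[of i] i by (simp add: t'_def joinpaths_def)
      next
        case False
        then have "i = Suc n" using i by simp
        then show ?thesis using Hn by (simp add: t'_def joinpaths_def pathfinish_def)
      qed
    qed
    show "t' (Suc n) = 1" by (simp add: t'_def)
  qed
qed

lemma arc_in_subspaceI:
  fixes g :: "real \<Rightarrow> 'a::metric_space"
  assumes "arc g" "path_image g \<subseteq> X"
  shows "arc_in (top_of_set X) g"
proof -
  have "continuous_map (top_of_set {0..1}) (top_of_set X) g" "inj_on g {0..1}"
    using assms by (auto simp: arc_def path_def path_image_def)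
  then show ?thesis
    unfolding arc_in_def
    by (intro continuous_imp_embedding_map Hausdorff_space_subtopology Hausdorff_space_euclidean)
      (auto simp: compact_space_subtopology compactin_euclidean_iff)
qed

section \<open>The cells that contain a point\<close>

definition cells :: "nat \<Rightarrow> nat \<Rightarrow> (real \<Rightarrow>\<^sub>C real) \<Rightarrow> nat list set" where
  "cells N L f = {w \<in> words N L. f \<in> cell N w}"

text \<open>
The block of trailing letters $b$ is as long as possible on both sides.
\<close>

lemma append_Cons_replicate_eqD:
  assumes "p @ a # replicate k b = p' @ a' # replicate k' b" "a \<noteq> b" "a' \<noteq> b"
  shows "p = p' \<and> a = a' \<and> k = k'"
proof -
  have eq: "replicate k b @ a # rev p = replicate k' b @ a' # rev p'"
    using arg_cong[OF assms(1), of rev] by simp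
  have *: "takeWhile ((=) b) (replicate k b @ a # r) = replicate k b" if "a \<noteq> b" for k a r
    using that by (induction k) auto
  have "k = k'"
    using arg_cong[OF eq, of "takeWhile ((=) b)"] assms(2,3) by (metis * length_replicate)
  with eq show ?thesis by auto
qed

lemma contract_eq_iff: "contract w f = contract w g \<longleftrightarrow> f = g"
  using inj_contract by (auto dest: injD)

lemma contract_vertex_in_cell: "b < N \<Longrightarrow> contract w (vertex b) \<in> cell N w"
  by (simp add: cell_def vertex_in_gasket)

text \<open>
The shared corner determines the last letters $b$ of the first word by injectivity of the
contraction, hence its decomposition, hence the second word. So no third cell contains it.
\<close>

lemma cells_contact:
  assumes "a \<noteq> b" "w = p @ a # replicate k b" "w' = p @ b # replicate k a"
    and "w \<in> words N L" "w' \<in> words N L"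
  shows "contract w (vertex b) = contract w' (vertex a)"
    and "cells N L (contract w (vertex b)) = {w, w'}"
    and "contract w (vertex b) \<notin> vertex ` {..<N}"
proof -
  have N: "a < N" "b < N" using assms by (auto simp: words_def)
  show eq: "contract w (vertex b) = contract w' (vertex a)"
    using assms by (simp add: halfway_vertex_commute)
  let ?q = "contract w (vertex b)"
  have in_cells: "w \<in> cells N L ?q" "w' \<in> cells N L ?q"
    unfolding cells_def using assms(4,5) contract_vertex_in_cell[OF N(2), of w] 
      contract_vertex_in_cell[OF N(1), of w'] eq by auto
  have "w'' = w'" if w'': "w'' \<in> cells N L ?q" "w'' \<noteq> w" for w''
  proof -
    have *: "?q \<in> cell N w" "?q \<in> cell N w''" "w'' \<in> words N L" 
      using in_cells(1) w'' by (auto simp: cells_def)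
    obtain p' a' b' k' where c: "a' \<noteq> b'" "w = p' @ a' # replicate k' b'"
      "w'' = p' @ b' # replicate k' a'" "?q = contract w (vertex b')"
      by (rule cells_Int[OF *(1,2) assms(4) *(3) w''(2)[symmetric]])
    then have "b' = b" by (simp only: contract_eq_iff vertex_inject)
    then show ?thesis using c assms append_Cons_replicate_eqD[of p a k b p' a' k'] by auto
  qed
  then show "cells N L ?q = {w, w'}" using in_cells by blast
  show "?q \<notin> vertex ` {..<N}"
  proof
    assume "?q \<in> vertex ` {..<N}"
    then obtain c where c: "c < N" "?q = vertex c" by auto
    then have "w = replicate L c" "w' = replicate L c"
      using in_cells vertex_in_cellD unfolding cells_def by auto
    then have "w = w'" by simp
    then show False using assms by simp
  qed
qed

lemma cells_touching:
  assumes "touching w w'" "w \<in> words N L" "w' \<in> words N L"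
  obtains a b where "a < N" "b < N" "contract w (vertex b) = contract w' (vertex a)"
    "cells N L (contract w (vertex b)) = {w, w'}" "contract w (vertex b) \<notin> vertex ` {..<N}"
proof -
  obtain p a b k where ab: "a \<noteq> b" "w = p @ a # replicate k b" "w' = p @ b # replicate k a"
    using assms(1) by (auto simp: touching_def)
  moreover have "a < N" "b < N" using ab assms by (auto simp: words_def)
  ultimately show ?thesis using that cells_contact[OF ab assms(2,3)] by blast
qed

lemma card_cells_le_2: "card (cells N L f) \<le> 2"
proof (cases "\<exists>w\<in>cells N L f. \<exists>w'\<in>cells N L f. w \<noteq> w'")
  case True
  then obtain w w' where w: "w \<in> words N L" "w' \<in> words N L" "f \<in> cell N w" "f \<in> cell N w'" "w \<noteq> w'"
    by (auto simp: cells_def)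
  obtain p a b k where ab: "a \<noteq> b" "w = p @ a # replicate k b" "w' = p @ b # replicate k a"
    "f = contract w (vertex b)"
    by (rule cells_Int[OF w(3,4,1,2,5)])
  have "cells N L f = {w, w'}" using cells_contact(2)[OF ab(1-3) w(1,2)] unfolding ab(4) .
  then show ?thesis by (simp add: card_insert_le_m1)
next
  case False
  then have "cells N L f \<subseteq> {SOME w. w \<in> cells N L f}" by (metis singleton_iff someI subsetI)
  then show ?thesis using card_mono[of "{SOME w. w \<in> cells N L f}" "cells N L f"] by simp
qed

lemma vertex_in_segment:
  assumes "vertex c \<in> closed_segment (vertex a) (vertex b)"
  shows "c = a \<or> c = b"
proof -
  obtain u where "vertex c = (1 - u) *\<^sub>R vertex a + u *\<^sub>R vertex b"
    using assms by (auto simp: closed_segment_def)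
  then have "coord (vertex c) c = coord ((1 - u) *\<^sub>R vertex a + u *\<^sub>R vertex b) c" by simp
  then show ?thesis by (auto simp: coord_vertex split: if_splits)
qed

text \<open>
Points of a cell other than its corners lie in no second cell and are not vertices of the gasket, so
that they do not touch the other sheet either.
\<close>

lemma cells_noncorner:
  assumes "g \<in> gasket N" "w \<in> words N L" "g \<notin> vertex ` {..<N}"
  shows "cells N L (contract w g) = {w}" "contract w g \<notin> vertex ` {..<N}"
proof -
  have w: "contract w g \<in> cell N w" using assms by (simp add: cell_def)
  have "w' = w" if "w' \<in> cells N L (contract w g)" for w'
  proof (rule ccontr)
    assume "w' \<noteq> w"
    have *: "contract w g \<in> cell N w'" "w' \<in> words N L" using that by (auto simp: cells_def)
    obtain b where "contract w g = contract w (vertex b)" "b < N"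
      by (rule cells_Int[OF w *(1) assms(2) *(2) \<open>w' \<noteq> w\<close>[symmetric]])
    then show False using assms(3) by (simp add: contract_eq_iff)
  qed
  then show "cells N L (contract w g) = {w}" using w assms(2) by (auto simp: cells_def)
  show "contract w g \<notin> vertex ` {..<N}"
  proof
    assume "contract w g \<in> vertex ` {..<N}"
    then obtain c where c: "c < N" "contract w g = vertex c" by auto
    then have "w = replicate L c" using vertex_in_cellD w assms(2) by metis
    then have "contract w g = contract w (vertex c)" using c by simp
    then have "g = vertex c" by (simp only: contract_eq_iff)
    then show False using assms(3) c by simp
  qed
qed

text \<open>
The path follows edges: inside each cell of the chain, the edge between the corners that it shares
with the two neighbouring cells. It meets cells outside the chain and vertices of the gasket at most
in its end points.
\<close>

lemma chain_path:
  assumes "chain (words N L) v w P" "a < N" "b < N"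
  shows "path_component ({f \<in> gasket N. cells N L f \<subseteq> set P \<and> f \<notin> vertex ` {..<N}}
           \<union> {contract v (vertex a), contract w (vertex b)})
           (contract v (vertex a)) (contract w (vertex b))"
  using assms
proof (induction P arbitrary: v a)
  case Nil
  then show ?case by (simp add: chain_def)
next
  case (Cons v' P)
  define A where "A P = {f \<in> gasket N. cells N L f \<subseteq> set P \<and> f \<notin> vertex ` {..<N}}" for P
  have [simp]: "v' = v" and v: "v \<in> words N L" using Cons.prems by (auto simp: chain_def)
  have seg: "path_component (A (v # P) \<union> {contract v (vertex a), contract v (vertex c)})
           (contract v (vertex a)) (contract v (vertex c))" if "c < N" for c
  proof -
    have "path_component (closed_segment (vertex a) (vertex c)) (vertex a) (vertex c)"
      by (simp add: path_component_linepath)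
    then have "path_component (contract v ` closed_segment (vertex a) (vertex c)) 
        (contract v (vertex a)) (contract v (vertex c))"
      using path_component_image continuous_on_contract by blast
    moreover have "contract v g \<in> A (v # P) \<union> {contract v (vertex a), contract v (vertex c)}"
      if "g \<in> closed_segment (vertex a) (vertex c)" for g
    proof -
      have "g \<in> gasket N" using gasket_edge[OF \<open>a < N\<close> \<open>c < N\<close>] that by auto
      moreover from this have "contract v g \<in> gasket N" 
        using cell_subset_gasket[OF v] by (auto simp: cell_def)
      ultimately show ?thesis
        using cells_noncorner[OF \<open>g \<in> gasket N\<close> v] vertex_in_segment[of _ a c] that
        by (cases "g \<in> vertex ` {..<N}") (auto simp: A_def)
    qed
    ultimately show ?thesis by (meson image_subsetI path_component_of_subset)
  qed
  show ?case
  proof (cases P)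
    case Nil
    then have "w = v" using Cons.prems by (simp add: chain_def)
    then show ?thesis using seg[OF \<open>b < N\<close>] by (simp add: A_def)
  next
    case (Cons v2 P')
    have 2: "touching v v2" "chain (words N L) v2 w P" "v2 \<in> words N L"
      using \<open>chain (words N L) v w (v' # P)\<close> Cons by (auto simp: chain_def)
    obtain c d where cd: "c < N" "d < N" "contract v (vertex d) = contract v2 (vertex c)"
        "cells N L (contract v (vertex d)) = {v, v2}" "contract v (vertex d) \<notin> vertex ` {..<N}"
      using cells_touching[OF 2(1) v 2(3)] .
    have "contract v (vertex d) \<in> gasket N"
      using contract_vertex_in_cell[OF cd(2)] cell_subset_gasket[OF v] by blast
    then have q: "contract v (vertex d) \<in> A (v # P)" using cd Cons by (simp add: A_def)
    have "A P \<subseteq> A (v # P)" by (auto simp: A_def)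
    have "path_component (A (v # P) \<union> {contract v (vertex a), contract w (vertex b)})
           (contract v (vertex a)) (contract v (vertex d))"
      by (rule path_component_of_subset[OF _ seg[OF cd(2)]]) (use q in auto)
    moreover have "path_component (A (v # P) \<union> {contract v (vertex a), contract w (vertex b)})
           (contract v (vertex d)) (contract w (vertex b))"
      unfolding cd(3)
      by (rule path_component_of_subset[OF _ Cons.IH[OF 2(2) cd(1) \<open>b < N\<close>, folded A_def]])
        (use q cd(3) \<open>A P \<subseteq> A (v # P)\<close> in auto)
    ultimately show ?thesis unfolding A_def[symmetric] by (auto intro: path_component_trans)
  qed
qed

section \<open>Two gaskets glued at finitely many vertices\<close>

text \<open>
The height of the second sheet above the first. On the gasket it vanishes exactly at the first $m$
vertices, which become the seams.
\<close>

definition offset :: "nat \<Rightarrow> (real \<Rightarrow>\<^sub>C real) \<Rightarrow> real" where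
  "offset m f = (\<Prod>j<m. 1 - coord f j)"

definition sheet :: "nat \<Rightarrow> bool \<Rightarrow> (real \<Rightarrow>\<^sub>C real) \<Rightarrow> (real \<Rightarrow>\<^sub>C real) \<times> real" where
  "sheet m s f = (f, if s then offset m f else 0)"

definition double :: "nat \<Rightarrow> nat \<Rightarrow> ((real \<Rightarrow>\<^sub>C real) \<times> real) set" where
  "double m N = (\<Union>s. sheet m s ` gasket N)"

definition tiles :: "nat \<Rightarrow> nat \<Rightarrow> nat \<Rightarrow> (real \<Rightarrow>\<^sub>C real) \<times> real \<Rightarrow> (bool \<times> nat list) set" where
  "tiles m N L q = {(s, w). w \<in> words N L \<and> q \<in> sheet m s ` cell N w}"

lemma fst_sheet [simp]: "fst (sheet m s f) = f"
  by (simp add: sheet_def)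

lemma continuous_on_sheet: "continuous_on S (sheet m s)"
  unfolding sheet_def offset_def
  by (cases s) (auto intro!: continuous_intros)

lemma offset_eq_0_iff:
  assumes "f \<in> gasket N" "m \<le> N"
  shows "offset m f = 0 \<longleftrightarrow> f \<in> vertex ` {..<m}"
proof
  assume "offset m f = 0"
  then obtain j where "j < m" "coord f j = 1" by (auto simp: offset_def)
  then show "f \<in> vertex ` {..<m}" using gasket_vertexI[OF assms(1), of j] assms(2) by auto
qed (auto simp: offset_def coord_vertex)

lemma sheet_eq_iff:
  assumes "f \<in> gasket N" "m \<le> N"
  shows "sheet m s f = sheet m t g \<longleftrightarrow> f = g \<and> (s = t \<or> f \<in> vertex ` {..<m})"
  using offset_eq_0_iff[OF assms] by (cases s; cases t) (auto simp: sheet_def)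

lemma compact_double: "compact (double m N)"
  unfolding double_def
  by (intro compact_UN compact_continuous_image continuous_on_sheet compact_gasket) simp

lemma gasket_path_connected: 
  assumes "f \<in> gasket N" "j < N" shows "path_component (gasket N) (vertex j) f"
  using path_from_vertex[OF assms(2,1)] by (rule path_component_of_subset[rotated]) auto

lemma connected_double:
  assumes "0 < m" "m \<le> N"
  shows "connected (double m N)"
proof -
  have path: "path_component (double m N) (sheet m False (vertex 0)) q" if q: "q \<in> double m N" for q
  proof -
    obtain s f where f: "q = sheet m s f" "f \<in> gasket N" using q by (auto simp: double_def)
    have "path_component (gasket N) (vertex 0) f" using gasket_path_connected[OF f(2)] assms by simp
    then have "path_component (sheet m s ` gasket N) (sheet m s (vertex 0)) q"
      using path_component_image continuous_on_sheet f(1) by blast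
    moreover have "sheet m s (vertex 0) = sheet m False (vertex 0)"
      using sheet_eq_iff[OF vertex_in_gasket[of 0 N] assms(2)] assms by auto
    ultimately show ?thesis
      by (metis UNIV_I UN_upper double_def path_component_of_subset)
  qed
  then have "path_connected (double m N)"
    unfolding path_connected_component by (meson path_component_sym path_component_trans)
  then show ?thesis by (rule path_connected_imp_connected)
qed

lemma tiles_sheet:
  assumes "f \<in> gasket N" "m \<le> N"
  shows "tiles m N L (sheet m s f) = {t. t = s \<or> f \<in> vertex ` {..<m}} \<times> cells N L f"
proof -
  have *: "sheet m s f \<in> sheet m t ` cell N w \<longleftrightarrow> f \<in> cell N w \<and> (s = t \<or> f \<in> vertex ` {..<m})" for t w
    using sheet_eq_iff[OF assms, of s t] by (metis imageE imageI)
  have "(t, w) \<in> tiles m N L (sheet m s f) \<longleftrightarrow> (t, w) \<in> {t. t = s \<or> f \<in> vertex ` {..<m}} \<times> cells N L f" for t w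
    unfolding tiles_def cells_def mem_Collect_eq case_prod_conv * mem_Sigma_iff by metis
  then show ?thesis by (intro set_eqI) (metis surj_pair)
qed

lemma double_eq_tiles: "double m N = (\<Union>v\<in>UNIV \<times> words N L. sheet m (fst v) ` cell N (snd v))"
proof -
  have "(\<Union>v\<in>UNIV \<times> W. F (fst v) (snd v)) = (\<Union>s. \<Union>w\<in>W. F s w)" 
    for F :: "bool \<Rightarrow> nat list \<Rightarrow> ((real \<Rightarrow>\<^sub>C real) \<times> real) set" and W
    by force
  from this[of "\<lambda>s w. sheet m s ` cell N w" "words N L"] show ?thesis
    unfolding double_def gasket_eq_Union_cells[of N L] image_UN by simp
qed

lemma tiles_subset: "tiles m N L q \<subseteq> UNIV \<times> words N L"
  by (auto simp: tiles_def)

text \<open>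
A point that lies in two tiles is a corner of one of them, whether the tiles belong to the same
sheet or to different ones.
\<close>

lemma finite_multiple_tiles:
  assumes "m \<le> N"
  shows "finite {q. \<exists>v\<in>tiles m N L q. \<exists>v'\<in>tiles m N L q. v \<noteq> v'}" (is "finite ?J")
proof (rule finite_subset)
  let ?K = "(\<lambda>(s, w, b). sheet m s (contract w (vertex b))) ` (UNIV \<times> words N L \<times> {..<N})"
  show "finite ?K" using finite_words by (intro finite_imageI finite_cartesian_product) auto
  show "?J \<subseteq> ?K"
  proof
    fix q assume "q \<in> ?J"
    then obtain s w s' w' where *: "(s, w) \<in> tiles m N L q" "(s', w') \<in> tiles m N L q" "(s, w) \<noteq> (s', w')"
      by auto
    obtain f where f: "f \<in> cell N w" "q = sheet m s f" "w \<in> words N L" 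
      using *(1) by (auto simp: tiles_def)
    have fg: "f \<in> gasket N" using f cell_subset_gasket by blast
    have "(s', w') \<in> {t. t = s \<or> f \<in> vertex ` {..<m}} \<times> cells N L f"
      using *(2) unfolding f(2) tiles_sheet[OF fg assms] .
    then have w': "w' \<in> cells N L f" "s' = s \<or> f \<in> vertex ` {..<m}" by auto
    have "\<exists>b<N. f = contract w (vertex b)"
    proof (rule ccontr)
      assume no: "\<not> ?thesis"
      obtain g where g: "g \<in> gasket N" "f = contract w g" using f(1) by (auto simp: cell_def)
      then have "g \<notin> vertex ` {..<N}" using no by auto
      from cells_noncorner[OF g(1) f(3) this, folded g(2)] 
      have "cells N L f = {w}" "f \<notin> vertex ` {..<N}" .
      moreover have "vertex ` {..<m} \<subseteq> vertex ` {..<N}" using assms by auto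
      ultimately have "w' = w" "s' = s" using w' by auto
      then show False using *(3) by simp
    qed
    then obtain b where "b < N" "f = contract w (vertex b)" by blast
    then show "q \<in> ?K" using f by (intro image_eqI[of _ _ "(s, w, b)"]) simp_all
  qed
qed

lemma dist_cell_bounded: 
  obtains D where "0 \<le> D" "\<And>w f g. f \<in> cell N w \<Longrightarrow> g \<in> cell N w \<Longrightarrow> dist f g \<le> D * (1/2) ^ length w"
proof -
  obtain D where D: "\<And>f g. f \<in> stage N 0 \<Longrightarrow> g \<in> stage N 0 \<Longrightarrow> dist f g \<le> D" "0 \<le> D"
    using dist_stage_bounded by blast
  have "dist f g \<le> D * (1/2) ^ length w" if fg: "f \<in> cell N w" "g \<in> cell N w" for w f g
  proof -
    obtain f0 g0 where "f0 \<in> gasket N" "g0 \<in> gasket N" "f = contract w f0" "g = contract w g0"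
      using fg by (auto simp: cell_def)
    then show ?thesis
      using D(1)[of f0 g0] gasket_subset_simplex[of N]
      by (simp add: dist_contract power_one_over divide_right_mono subset_iff del: stage.simps)
  qed
  then show ?thesis using that D(2) by blast
qed

text \<open>
There are at most two sheets through $q$, and each depends continuously on the point of the gasket
below $q$, so it suffices that the cells around that point are small.
\<close>

lemma tiles_small:
  assumes "open U" "q \<in> double m N" "q \<in> U"
  obtains L where "\<And>s w. (s, w) \<in> tiles m N L q \<Longrightarrow> sheet m s ` cell N w \<subseteq> U"
proof -
  obtain f where f: "f = fst q" "f \<in> gasket N" using assms(2) by (auto simp: double_def)
  have "\<exists>d>0. sheet m s f = q \<longrightarrow> (\<forall>g\<in>gasket N. dist g f < d \<longrightarrow> sheet m s g \<in> U)" for s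
  proof (cases "sheet m s f = q")
    case True
    obtain e where e: "e > 0" "ball q e \<subseteq> U" using assms(1,3) open_contains_ball by blast
    then obtain d where "d > 0" "\<And>g. g \<in> gasket N \<Longrightarrow> dist g f < d \<Longrightarrow> dist (sheet m s g) (sheet m s f) < e"
      using continuous_on_sheet[of "gasket N" m s] f(2) unfolding continuous_on_iff by metis
    then have "sheet m s g \<in> ball q e" if "g \<in> gasket N" "dist g f < d" for g
      using that True by (simp add: dist_commute)
    then show ?thesis using e(2) \<open>d > 0\<close> by blast
  qed (auto intro: exI[of _ 1])
  then obtain d where d: "\<And>s. d s > 0" 
    "\<And>s g. sheet m s f = q \<Longrightarrow> g \<in> gasket N \<Longrightarrow> dist g f < d s \<Longrightarrow> sheet m s g \<in> U"
    by metis
  define \<delta> where "\<delta> = min (d True) (d False)"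
  have \<delta>: "\<delta> > 0" "\<delta> \<le> d s" for s using d(1) by (cases s; simp add: \<delta>_def)+
  obtain D where D: "0 \<le> D" "\<And>w f g. f \<in> cell N w \<Longrightarrow> g \<in> cell N w \<Longrightarrow> dist f g \<le> D * (1/2) ^ length w"
    using dist_cell_bounded by blast
  obtain L where L: "D * (1/2) ^ L < \<delta>"
    using LIMSEQ_D[OF tendsto_mult_right_zero[OF LIMSEQ_realpow_zero[of "1/2"]], of \<delta> D] D(1) \<delta>(1) by auto
  show ?thesis
  proof (rule that[of L])
    fix s w assume "(s, w) \<in> tiles m N L q"
    then obtain h where h: "w \<in> words N L" "h \<in> cell N w" "q = sheet m s h" by (auto simp: tiles_def)
    then have "h = f" using f by simp
    show "sheet m s ` cell N w \<subseteq> U"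
    proof
      fix p assume "p \<in> sheet m s ` cell N w"
      then obtain g where g: "g \<in> cell N w" "p = sheet m s g" by auto
      have "dist g h \<le> D * (1/2) ^ L" using D(2)[OF g(1) h(2)] h(1) by (simp add: words_def)
      then have "dist g f < d s" using L \<delta>(2)[of s] \<open>h = f\<close> by simp
      moreover have "g \<in> gasket N" using g h cell_subset_gasket by blast
      ultimately show "p \<in> U" using d(2)[of s g] h(3) \<open>h = f\<close> g(2) by simp
    qed
  qed
qed

text \<open>
Remove from the double all tiles of a fine level that miss $q$. What remains is contained in the
tiles that contain $q$, and a boundary point lies in a tile of either kind.
\<close>

lemma double_finite_frontier_base:
  assumes "m \<le> N" "openin (top_of_set (double m N)) U" "q \<in> U"
  obtains V where "openin (top_of_set (double m N)) V" "q \<in> V" "V \<subseteq> U" 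
    "finite (top_of_set (double m N) frontier_of V)"
proof -
  let ?X = "double m N"
  obtain T where T: "open T" "U = ?X \<inter> T" using assms(2) openin_open by metis
  have q: "q \<in> ?X" "q \<in> T" using assms(3) T by auto
  obtain L where L: "\<And>s w. (s, w) \<in> tiles m N L q \<Longrightarrow> sheet m s ` cell N w \<subseteq> T"
    using tiles_small[OF T(1) q] by blast
  define tile where "tile v = sheet m (fst v) ` cell N (snd v)" for v
  have closed: "closed (tile v)" for v
    unfolding tile_def
    by (intro compact_imp_closed compact_continuous_image continuous_on_sheet compact_cell)
  have fin: "finite (UNIV \<times> words N L :: (bool \<times> nat list) set)" using finite_words by simp
  have tiles: "v \<in> tiles m N L p \<longleftrightarrow> v \<in> UNIV \<times> words N L \<and> p \<in> tile v" for v p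
    by (cases v) (auto simp: tiles_def tile_def)
  define In where "In = \<Union> (tile ` tiles m N L q)"
  define Out where "Out = \<Union> (tile ` (UNIV \<times> words N L - tiles m N L q))"
  have X: "?X = In \<union> Out" 
    unfolding double_eq_tiles[of m N L] In_def Out_def tile_def[symmetric] using tiles_subset by fast
  have cl: "closed In" "closed Out"
    unfolding In_def Out_def 
    by (intro closed_UN ballI closed finite_subset[OF tiles_subset fin] finite_Diff fin)+
  define V where "V = ?X - Out"
  have "V \<subseteq> In" using X by (auto simp: V_def)
  show ?thesis
  proof
    show op: "openin (top_of_set ?X) V"
      unfolding V_def using cl(2) by (simp add: openin_diff closedin_closed_Int Diff_Int_distrib openin_open Diff_eq) blast
    show "q \<in> V" using q(1) tiles by (auto simp: V_def Out_def)
    show "V \<subseteq> U" using \<open>V \<subseteq> In\<close> L T(2) by (fastforce simp: V_def In_def tile_def)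
    have "top_of_set ?X frontier_of V \<subseteq> In \<inter> Out"
    proof -
      define C where "C = top_of_set ?X closure_of V"
      have "closedin (top_of_set ?X) In" using cl(1) X by (simp add: closed_subset)
      then have "C \<subseteq> In" unfolding C_def using \<open>V \<subseteq> In\<close> by (simp add: closure_of_minimal)
      moreover have "C \<subseteq> ?X" 
        unfolding C_def using closure_of_subset_topspace[of "top_of_set ?X" V] by simp
      moreover have "?X - V \<subseteq> Out" by (auto simp: V_def)
      ultimately have "C - V \<subseteq> In \<inter> Out" by blast
      then show ?thesis
        by (simp add: frontier_of_def interior_of_openin[OF op] C_def)
    qed
    also have "\<dots> \<subseteq> {q. \<exists>v\<in>tiles m N L q. \<exists>v'\<in>tiles m N L q. v \<noteq> v'}"
    proof
      fix p assume "p \<in> In \<inter> Out"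
      then obtain v v' where "v \<in> tiles m N L q" "p \<in> tile v" "v' \<in> UNIV \<times> words N L - tiles m N L q" "p \<in> tile v'"
        by (auto simp: In_def Out_def)
      then have "v \<in> tiles m N L p" "v' \<in> tiles m N L p" "v \<noteq> v'" using tiles by blast+
      then show "p \<in> {q. \<exists>v\<in>tiles m N L q. \<exists>v'\<in>tiles m N L q. v \<noteq> v'}" by blast
    qed
    finally show "finite (top_of_set ?X frontier_of V)"
      using finite_multiple_tiles[OF assms(1)] finite_subset by blast
  qed
qed

text \<open>
The $m + 2$ points are vertices beyond the first $m$ ones, taken alternately on the two sheets.
Between consecutive visits the arc meets the intersection of the two sheets; this yields $m + 1$
different points among the $m$ seams.
\<close>

lemma not_strongly_arc_connected_double:
  assumes "2 * m + 2 \<le> N"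
  shows "\<not> strongly_arc_connected (m + 2) (top_of_set (double m N))"
proof
  assume sac: "strongly_arc_connected (m + 2) (top_of_set (double m N))"
  have "m \<le> N" using assms by simp
  define A where "A s = sheet m s ` gasket N" for s
  have closed: "closed (A s)" for s
    unfolding A_def by (intro compact_imp_closed compact_continuous_image continuous_on_sheet compact_gasket)
  \<comment> \<open>The indices of these vertices start at $m$, so none of them is a seam.\<close>
  define x where "x i = sheet m (even i) (vertex (m + i - 1))" for i
  have v: "vertex (m + i - 1) \<in> gasket N" "vertex (m + i - 1) \<notin> vertex ` {..<m}"
    if "i \<in> {1..m+2}" for i using that assms by (auto intro!: vertex_in_gasket)
  have x_in: "x i \<in> A (even i)" "x i \<notin> A (\<not> even i)" if "i \<in> {1..m+2}" for i
    using v[OF that] sheet_eq_iff[OF v(1)[OF that] \<open>m \<le> N\<close>] by (auto simp: x_def A_def)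
  have "x \<in> {1..m+2} \<rightarrow> topspace (top_of_set (double m N))"
    using x_in(1) unfolding double_def A_def topspace_euclidean_subtopology by blast
  moreover have "inj_on x {1..m+2}"
  proof (rule inj_onI)
    fix i k assume ik: "i \<in> {1..m+2}" "k \<in> {1..m+2}" "x i = x k"
    then have "vertex (m + i - 1) = vertex (m + k - 1)" by (metis fst_sheet x_def)
    then have "m + i - 1 = m + k - 1" by (simp only: vertex_inject)
    then show "i = k" using ik by auto
  qed
  ultimately have "\<exists>\<alpha> t. arc_in (top_of_set (double m N)) \<alpha> \<and> t \<in> {1..m+2} \<rightarrow> {0..1::real} \<and>
      strict_mono_on {1..m+2} t \<and> (\<forall>i\<in>{1..m+2}. \<alpha> (t i) = x i)"
    using sac[unfolded strongly_arc_connected_def, rule_format, of x] by blast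
  then obtain \<alpha> t where \<alpha>: "arc_in (top_of_set (double m N)) \<alpha>"
    and t: "t \<in> {1..m+2} \<rightarrow> {0..1::real}" "strict_mono_on {1..m+2} t" "\<And>i. i \<in> {1..m+2} \<Longrightarrow> \<alpha> (t i) = x i"
    by blast
  have cont: "continuous_on {0..1} \<alpha>" and img: "\<alpha> ` {0..1} \<subseteq> double m N" and inj: "inj_on \<alpha> {0..1}"
  proof -
    have "homeomorphic_map (top_of_set {0..1}) (subtopology (top_of_set (double m N)) (\<alpha> ` {0..1})) \<alpha>"
      using \<alpha> by (simp add: arc_in_def embedding_map_def)
    from homeomorphic_imp_continuous_map[OF this] homeomorphic_imp_injective_map[OF this]
    show "continuous_on {0..1} \<alpha>" "\<alpha> ` {0..1} \<subseteq> double m N" "inj_on \<alpha> {0..1}"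
      by (auto simp: continuous_map_in_subtopology image_subset_iff Pi_iff)
  qed
  have X: "double m N = A True \<union> A False" by (auto simp: double_def A_def UNIV_bool)
  have t01: "0 \<le> t i" "t i \<le> 1" if "i \<in> {1..m+2}" for i
    using funcset_mem[OF t(1) that] by auto
  have "\<exists>u. t i < u \<and> u < t (Suc i) \<and> \<alpha> u \<in> A True \<inter> A False" if i: "i \<in> {1..m+1}" for i
  proof -
    have lt: "t i < t (Suc i)" using strict_mono_onD[OF t(2), of i "Suc i"] i by simp
    have sub: "{t i..t (Suc i)} \<subseteq> {0..1}" using t01(1)[of i] t01(2)[of "Suc i"] i by auto
    have conn: "connected (\<alpha> ` {t i..t (Suc i)})"
      using cont sub by (intro connected_continuous_image) (auto intro: continuous_on_subset)
    have "A True \<inter> A False \<inter> \<alpha> ` {t i..t (Suc i)} \<noteq> {}"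
    proof
      assume "A True \<inter> A False \<inter> \<alpha> ` {t i..t (Suc i)} = {}"
      moreover have "\<alpha> ` {t i..t (Suc i)} \<subseteq> A True \<union> A False"
        using image_mono[OF sub, of \<alpha>] img unfolding X by (rule order_trans)
      ultimately have "A True \<inter> \<alpha> ` {t i..t (Suc i)} = {} \<or> A False \<inter> \<alpha> ` {t i..t (Suc i)} = {}"
        using conn closed unfolding connected_closed by blast
      moreover have "x i \<in> \<alpha> ` {t i..t (Suc i)}" "x (Suc i) \<in> \<alpha> ` {t i..t (Suc i)}"
        using t(3)[of i] t(3)[of "Suc i"] i lt by (auto simp: image_iff intro: bexI[of _ "t i"] bexI[of _ "t (Suc i)"])
      moreover have "x i \<in> A (even i)" "x (Suc i) \<in> A (\<not> even i)"
        using x_in(1)[of i] x_in(1)[of "Suc i"] i by auto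
      ultimately show False by (cases "even i") auto
    qed
    then obtain u where u: "u \<in> {t i..t (Suc i)}" "\<alpha> u \<in> A True \<inter> A False" by blast
    have "u \<noteq> t i" "u \<noteq> t (Suc i)"
      using u(2) t(3)[of i] t(3)[of "Suc i"] x_in(2)[of i] x_in(2)[of "Suc i"] i
      by (cases "even i"; auto)+
    then show ?thesis using u by (intro exI[of _ u]) auto
  qed
  then obtain u where u: "\<And>i. i \<in> {1..m+1} \<Longrightarrow> t i < u i \<and> u i < t (Suc i) \<and> \<alpha> (u i) \<in> A True \<inter> A False"
    by metis
  have mono: "u i < u k" if "i \<in> {1..m+1}" "k \<in> {1..m+1}" "i < k" for i k
  proof -
    have "u i < t (Suc i)" using u that by blast
    also have "t (Suc i) \<le> t k" using strict_mono_onD[OF t(2), of "Suc i" k] that by (cases "Suc i = k") auto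
    also have "\<dots> < u k" using u that by blast
    finally show ?thesis .
  qed
  have u01: "u i \<in> {0..1}" if "i \<in> {1..m+1}" for i
    using u[OF that] t01(1)[of i] t01(2)[of "Suc i"] that by auto
  have "inj_on (\<alpha> \<circ> u) {1..m+1}"
  proof (rule comp_inj_on)
    show "inj_on u {1..m+1}" using mono by (metis inj_onI less_irrefl linorder_neqE_nat)
    show "inj_on \<alpha> (u ` {1..m+1})" using inj u01 by (auto intro: inj_on_subset)
  qed
  moreover have "(\<alpha> \<circ> u) ` {1..m+1} \<subseteq> (sheet m True \<circ> vertex) ` {..<m}"
  proof
    fix p assume "p \<in> (\<alpha> \<circ> u) ` {1..m+1}"
    then have "p \<in> A True \<inter> A False" using u by auto
    then obtain f g where fg: "f \<in> gasket N" "p = sheet m True f" "p = sheet m False g" by (auto simp: A_def)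
    then show "p \<in> (sheet m True \<circ> vertex) ` {..<m}"
      using sheet_eq_iff[OF fg(1) \<open>m \<le> N\<close>, of True False g] by auto
  qed
  ultimately have "card {1..m+1} \<le> card ((sheet m True \<circ> vertex) ` {..<m})"
    by (metis card_inj_on_le finite_imageI finite_lessThan)
  also have "\<dots> \<le> m" using card_image_le[of "{..<m}" "sheet m True \<circ> vertex"] by simp
  finally show False by simp
qed

section \<open>An arc through a separated itinerary\<close>

lemma replicate_in_words: "a < N \<Longrightarrow> replicate L a \<in> words N L"
  by (auto simp: words_def)

lemma snoc_in_words: "p @ [a] \<in> words N (Suc L) \<longleftrightarrow> p \<in> words N L \<and> a < N"
  by (auto simp: words_def)

lemma tiles_butlast:
  assumes "(s, p @ [a]) \<in> tiles m N (Suc L) q"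
  shows "(s, p) \<in> tiles m N L q"
proof -
  have "[a] \<in> words N 1" "p \<in> words N L" using assms by (auto simp: tiles_def words_def)
  then show ?thesis
    using assms cell_append_subset[of "[a]" N 1 p] by (auto simp: tiles_def)
qed

lemma tiles_vertex:
  assumes "e < m" "m \<le> N"
  shows "tiles m N L (sheet m s (vertex e)) = UNIV \<times> {replicate L e}"
proof -
  have e: "e < N" using assms by simp
  have "vertex e \<in> cell N (replicate L e)"
    using contract_vertex_in_cell[OF e, of "replicate L e"] by simp
  then have "cells N L (vertex e) = {replicate L e}"
    unfolding cells_def using vertex_in_cellD[OF _ _ e] replicate_in_words[OF e] by blast
  moreover have "vertex e \<in> vertex ` {..<m}" using assms by simp
  ultimately show ?thesis using tiles_sheet[OF vertex_in_gasket[OF e] assms(2)] by simp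
qed

text \<open>
The situation after all choices except for the chains have been made. Point $x_k$ lies on sheet
$s_k$ in the cell \<open>p k @ [a k]\<close> of level $K + 1$, its home, where it corresponds to the point
$h_k$ of the gasket. The arc is going to enter the home through its corner \<open>c True k\<close>, that is from
the neighbour \<open>p k @ [c True k]\<close>, and to leave it through its corner \<open>c False k\<close>. If the points $x_i$
and $x_{i+1}$ are on different sheets, vertex $e_i$ is the seam that the arc uses between them. On
level $K$, no tile contains two of the points, or one of the points and a seam in use.
\<close>

locale itinerary =
  fixes m N n K :: nat
    and x :: "nat \<Rightarrow> (real \<Rightarrow>\<^sub>C real) \<times> real"
    and s :: "nat \<Rightarrow> bool"
    and p :: "nat \<Rightarrow> nat list" and a :: "nat \<Rightarrow> nat" and h :: "nat \<Rightarrow> (real \<Rightarrow>\<^sub>C real)"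
    and c :: "bool \<Rightarrow> nat \<Rightarrow> nat"
    and e :: "nat \<Rightarrow> nat"
  assumes mN: "m \<le> N" and nN: "9 * n \<le> N" and n2: "2 \<le> n"
    and p: "k \<in> {1..n} \<Longrightarrow> p k \<in> words N K"
    and a: "k \<in> {1..n} \<Longrightarrow> a k < N"
    and h: "k \<in> {1..n} \<Longrightarrow> h k \<in> gasket N"
    and x: "k \<in> {1..n} \<Longrightarrow> x k = sheet m (s k) (contract (p k @ [a k]) (h k))"
    and separated: "k \<in> {1..n} \<Longrightarrow> l \<in> {1..n} \<Longrightarrow> k \<noteq> l \<Longrightarrow> tiles m N K (x k) \<inter> tiles m N K (x l) = {}"
    and c: "k \<in> {1..n} \<Longrightarrow> c b k < N" "k \<in> {1..n} \<Longrightarrow> c b k \<noteq> a k"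
    and c_distinct: "k \<in> {1..n} \<Longrightarrow> c False k \<noteq> c True k"
    and c_fresh: "k \<in> {1..n} \<Longrightarrow> (s k, p k @ [c b k]) \<notin> tiles m N (Suc K) (x k)"
    and e: "i \<in> {1..<n} \<Longrightarrow> s i \<noteq> s (Suc i) \<Longrightarrow> e i < m"
    and e_inj: "inj_on e {i \<in> {1..<n}. s i \<noteq> s (Suc i)}"
    and e_fresh: "i \<in> {1..<n} \<Longrightarrow> s i \<noteq> s (Suc i) \<Longrightarrow> k \<in> {1..n} \<Longrightarrow>
      tiles m N K (x k) \<inter> tiles m N K (sheet m False (vertex (e i))) = {}"
begin

definition home :: "nat \<Rightarrow> bool \<times> nat list" where
  "home k = (s k, p k @ [a k])"

text \<open>
Leg $i$ leads from point $i$ to point $i + 1$; the truth value selects its start or its finish.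
\<close>

definition station :: "nat \<Rightarrow> bool \<Rightarrow> nat" where
  "station i b = (if b then Suc i else i)"

text \<open>
The ends of the chain of leg $i$ on sheet \<open>\<sigma>\<close>. If the leg starts or finishes on the other sheet,
the chain on \<open>\<sigma>\<close> ends in the cell at the seam instead.
\<close>

definition terminal :: "bool \<Rightarrow> nat \<Rightarrow> bool \<Rightarrow> nat list" where
  "terminal \<sigma> i b = (if s (station i b) = \<sigma> then p (station i b) @ [c b (station i b)] else replicate (Suc K) (e i))"

definition legs :: "bool \<Rightarrow> nat set" where
  "legs \<sigma> = {i \<in> {1..<n}. \<exists>b. s (station i b) = \<sigma>}"

definition occupied :: "bool \<Rightarrow> nat list set" where
  "occupied \<sigma> = {w. \<exists>k\<in>{1..n}. (\<sigma>, w) \<in> tiles m N (Suc K) (x k)}"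

lemma station: "i \<in> {1..<n} \<Longrightarrow> station i b \<in> {1..n}"
  by (auto simp: station_def)

lemma local_point: "k \<in> {1..n} \<Longrightarrow> contract (p k @ [a k]) (h k) \<in> gasket N"
  using cell_subset_gasket[of "p k @ [a k]" N "Suc K"] p a h by (auto simp: cell_def snoc_in_words)

lemma home_in_tiles: "k \<in> {1..n} \<Longrightarrow> home k \<in> tiles m N (Suc K) (x k)"
  using x[of k] h[of k] p[of k] a[of k] by (auto simp: home_def tiles_def cell_def snoc_in_words)

lemma separated_fine: 
  assumes "k \<in> {1..n}" "l \<in> {1..n}" "v \<in> tiles m N (Suc K) (x k)" "v \<in> tiles m N (Suc K) (x l)"
  shows "k = l"
proof (rule ccontr)
  assume "k \<noteq> l"
  obtain \<sigma> w where v: "v = (\<sigma>, w)" by (cases v)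
  then have "w \<in> words N (Suc K)" using assms(3) by (auto simp: tiles_def)
  then have w: "w = butlast w @ [last w]" by (cases w rule: rev_cases) (auto simp: words_def)
  have "(\<sigma>, butlast w) \<in> tiles m N K (x k)" "(\<sigma>, butlast w) \<in> tiles m N K (x l)"
    using tiles_butlast assms(3,4) unfolding v by (metis w)+
  then show False using separated[OF assms(1,2) \<open>k \<noteq> l\<close>] by blast
qed

lemma block_in_tiles: "k \<in> {1..n} \<Longrightarrow> (s k, p k) \<in> tiles m N K (x k)"
  using home_in_tiles[of k] unfolding home_def by (rule tiles_butlast)

lemma block_inj: 
  assumes "k \<in> {1..n}" "l \<in> {1..n}" "s k = s l" "p k = p l"
  shows "k = l"
proof (rule ccontr)
  assume "k \<noteq> l"
  have "(s k, p k) \<in> tiles m N K (x k) \<inter> tiles m N K (x l)"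
    using block_in_tiles[OF assms(1)] block_in_tiles[OF assms(2)] assms(3,4) by simp
  then show False using separated[OF assms(1,2) \<open>k \<noteq> l\<close>] by simp
qed

lemma crossing_unoccupied:
  assumes "i \<in> {1..<n}" "s i \<noteq> s (Suc i)" "k \<in> {1..n}"
  shows "(\<sigma>, replicate K (e i)) \<notin> tiles m N K (x k)"
  using e_fresh[OF assms] tiles_vertex[OF e[OF assms(1,2)] mN] by blast

lemma replicate_Suc_snoc: "replicate (Suc K) j = replicate K j @ [j]"
  by (metis replicate_Suc replicate_append_same)

lemma terminal_free:
  assumes i: "i \<in> legs \<sigma>"
  shows "terminal \<sigma> i b \<in> words N (Suc K) - occupied \<sigma>"
proof (cases "s (station i b) = \<sigma>")
  case True
  define k where "k = station i b"
  have k: "k \<in> {1..n}" using station i by (auto simp: legs_def k_def)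
  have t: "terminal \<sigma> i b = p k @ [c b k]" "s k = \<sigma>" using True by (simp_all add: terminal_def k_def)
  have "p k @ [c b k] \<notin> occupied \<sigma>"
  proof
    assume "p k @ [c b k] \<in> occupied \<sigma>"
    then obtain l where l: "l \<in> {1..n}" "(\<sigma>, p k @ [c b k]) \<in> tiles m N (Suc K) (x l)"
      by (auto simp: occupied_def)
    have "k = l"
    proof (rule ccontr)
      assume "k \<noteq> l"
      then show False using separated[OF k l(1)] tiles_butlast[OF l(2)] block_in_tiles[OF k] t(2) by blast
    qed
    then show False using c_fresh[OF k] l(2) t(2) by simp
  qed
  then show ?thesis using t(1) p[OF k] c(1)[OF k] by (simp add: snoc_in_words)
next
  case False
  then have cross: "i \<in> {1..<n}" "s i \<noteq> s (Suc i)" using i by (auto simp: legs_def station_def split: if_splits)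
  have "replicate (Suc K) (e i) \<notin> occupied \<sigma>"
  proof
    assume "replicate (Suc K) (e i) \<in> occupied \<sigma>"
    then obtain l where "l \<in> {1..n}" "(\<sigma>, replicate K (e i) @ [e i]) \<in> tiles m N (Suc K) (x l)"
      unfolding occupied_def replicate_Suc_snoc by blast
    then show False using crossing_unoccupied[OF cross] tiles_butlast by blast
  qed
  then show ?thesis using False e[OF cross] mN replicate_in_words[of "e i" N "Suc K"]
    by (simp add: terminal_def)
qed

text \<open>
Ends near points differ because the cells of level $K$ around different points are disjoint and
because \<open>c False k\<close> and \<open>c True k\<close> differ; ends at seams differ because $e$ is injective, and because
a leg with an end on sheet \<open>\<sigma>\<close> has at most one end elsewhere.
\<close>

lemma terminal_inj: "inj_on (\<lambda>(i, b). terminal \<sigma> i b) (legs \<sigma> \<times> UNIV)"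
proof -
  have cross: "i \<in> {1..<n} \<and> s i \<noteq> s (Suc i)" if "i \<in> legs \<sigma>" "s (station i b) \<noteq> \<sigma>" for i b
    using that by (auto simp: legs_def station_def split: if_splits)
  have mixed: "terminal \<sigma> i b \<noteq> terminal \<sigma> j d"
    if "i \<in> legs \<sigma>" "j \<in> legs \<sigma>" "s (station i b) = \<sigma>" "s (station j d) \<noteq> \<sigma>" for i b j d
  proof
    assume "terminal \<sigma> i b = terminal \<sigma> j d"
    then have "p (station i b) @ [c b (station i b)] = replicate K (e j) @ [e j]"
      using that by (simp add: terminal_def replicate_append_same)
    then have "p (station i b) = replicate K (e j)" by simp
    moreover have k: "station i b \<in> {1..n}" using station that(1) by (auto simp: legs_def)
    ultimately have "(\<sigma>, replicate K (e j)) \<in> tiles m N K (x (station i b))"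
      using block_in_tiles[OF k] that(3) by simp
    then show False using crossing_unoccupied cross[OF that(2,4)] k by blast
  qed
  have "i = j \<and> b = d" if ij: "i \<in> legs \<sigma>" "j \<in> legs \<sigma>" and eq: "terminal \<sigma> i b = terminal \<sigma> j d" for i b j d
  proof (cases "s (station i b) = \<sigma>")
    case True
    then have True': "s (station j d) = \<sigma>" using mixed ij eq by metis
    have k: "station i b \<in> {1..n}" "station j d \<in> {1..n}" using station ij by (auto simp: legs_def)
    have eq': "p (station i b) = p (station j d)" "c b (station i b) = c d (station j d)"
      using eq True True' by (auto simp: terminal_def)
    then have kk: "station i b = station j d" using block_inj[OF k] True True' by simp
    then have "b = d" using c_distinct[OF k(1)] eq'(2) by (cases b; cases d) auto
    then show ?thesis using kk by (simp add: station_def split: if_splits)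
  next
    case False
    then have False': "s (station j d) \<noteq> \<sigma>" using mixed ij eq by metis
    have "e i = e j" using eq False False' by (simp add: terminal_def)
    then have "i = j" using cross[OF ij(1) False] cross[OF ij(2) False'] e_inj by (auto dest: inj_onD)
    moreover have "b = d" 
      using ij False False' \<open>i = j\<close> by (cases b; cases d) (auto simp: legs_def station_def split: if_splits)
    ultimately show ?thesis by simp
  qed
  then show ?thesis unfolding inj_on_def by auto
qed

lemma card_occupied: "finite (occupied \<sigma>)" "card (occupied \<sigma>) \<le> 2 * n"
proof -
  have *: "occupied \<sigma> \<subseteq> (\<Union>k\<in>{1..n}. cells N (Suc K) (contract (p k @ [a k]) (h k)))"
  proof
    fix w assume "w \<in> occupied \<sigma>"
    then obtain k where k: "k \<in> {1..n}" "(\<sigma>, w) \<in> tiles m N (Suc K) (x k)"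
      unfolding occupied_def by blast
    have "w \<in> cells N (Suc K) (contract (p k @ [a k]) (h k))"
      using k(2) unfolding x[OF k(1)] tiles_sheet[OF local_point[OF k(1)] mN] by blast
    then show "w \<in> (\<Union>k\<in>{1..n}. cells N (Suc K) (contract (p k @ [a k]) (h k)))"
      using k(1) by blast
  qed
  have fin: "finite (cells N (Suc K) f)" for f
    using finite_words by (auto simp: cells_def intro: rev_finite_subset)
  then show "finite (occupied \<sigma>)" using * finite_subset by blast
  have "card (occupied \<sigma>) \<le> card (\<Union>k\<in>{1..n}. cells N (Suc K) (contract (p k @ [a k]) (h k)))"
    using fin by (intro card_mono *) auto
  also have "\<dots> \<le> (\<Sum>k\<in>{1..n}. card (cells N (Suc K) (contract (p k @ [a k]) (h k))))"
    by (rule card_UN_le) simp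
  also have "\<dots> \<le> (\<Sum>k\<in>{1..n}. 2)" by (intro sum_mono card_cells_le_2)
  finally show "card (occupied \<sigma>) \<le> 2 * n" by simp
qed

text \<open>
There are fewer than $n$ legs, and the $n$ points occupy at most $2n$ cells of a sheet. So the demand
of \<open>disjoint_chains\<close> is at most $5n + 4n$, whence the bound $9n$ on $N$ in the locale.
\<close>

lemma routes_exist:
  "\<exists>P. (\<forall>i\<in>legs \<sigma>. chain (words N (Suc K) - occupied \<sigma>) (terminal \<sigma> i False) (terminal \<sigma> i True) (P i)) \<and>
       (\<forall>i\<in>legs \<sigma>. \<forall>k\<in>legs \<sigma>. i \<noteq> k \<longrightarrow> set (P i) \<inter> set (P k) = {})"
proof (rule disjoint_chains)
  show "finite (legs \<sigma>)" by (simp add: legs_def)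
  have "legs \<sigma> \<subseteq> {1..<n}" by (auto simp: legs_def)
  then have "card (legs \<sigma>) \<le> n" using card_mono[of "{1..<n}" "legs \<sigma>"] by simp
  then show "5 * card (legs \<sigma>) + 2 * card (occupied \<sigma>) \<le> N"
    using card_occupied(2)[of \<sigma>] nN by linarith
qed (use card_occupied terminal_free terminal_inj in auto)

definition route :: "bool \<Rightarrow> nat \<Rightarrow> nat list list" where
  "route \<sigma> = (SOME P. (\<forall>i\<in>legs \<sigma>. chain (words N (Suc K) - occupied \<sigma>) (terminal \<sigma> i False) (terminal \<sigma> i True) (P i)) \<and>
       (\<forall>i\<in>legs \<sigma>. \<forall>k\<in>legs \<sigma>. i \<noteq> k \<longrightarrow> set (P i) \<inter> set (P k) = {}))"

lemma route:
  "i \<in> legs \<sigma> \<Longrightarrow> chain (words N (Suc K) - occupied \<sigma>) (terminal \<sigma> i False) (terminal \<sigma> i True) (route \<sigma> i)"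
  "i \<in> legs \<sigma> \<Longrightarrow> k \<in> legs \<sigma> \<Longrightarrow> i \<noteq> k \<Longrightarrow> set (route \<sigma> i) \<inter> set (route \<sigma> k) = {}"
  using someI_ex[OF routes_exist[of \<sigma>], folded route_def] by blast+

text \<open>
The interior tiles of leg $i$, on one sheet or on both.
\<close>

definition corridor :: "nat \<Rightarrow> (bool \<times> nat list) set" where
  "corridor i = {(\<sigma>, w). i \<in> legs \<sigma> \<and> w \<in> set (route \<sigma> i)}"

lemma corridor_disjoint: "i \<noteq> k \<Longrightarrow> corridor i \<inter> corridor k = {}"
  using route(2) by (fastforce simp: corridor_def)

lemma corridor_avoids: "k \<in> {1..n} \<Longrightarrow> tiles m N (Suc K) (x k) \<inter> corridor i = {}"
  using route(1) by (fastforce simp: corridor_def chain_def occupied_def)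

lemma terminal_in_route: "i \<in> legs \<sigma> \<Longrightarrow> terminal \<sigma> i b \<in> set (route \<sigma> i)"
  using route(1)[of i \<sigma>] unfolding chain_def by (cases b) (metis hd_in_set last_in_set)+

text \<open>
The part of leg $i$ between the homes of its two points, characterised by tiles alone: such a point
lies in the corridor of $i$ and in no tile other than those of this corridor and the two homes.
Disjointness of passages is then a matter of disjoint corridors, although tiles of different
corridors may share corners.
\<close>

definition passage :: "nat \<Rightarrow> ((real \<Rightarrow>\<^sub>C real) \<times> real) set" where
  "passage i = {q \<in> double m N. tiles m N (Suc K) q \<subseteq> corridor i \<union> {home i, home (Suc i)} \<and>
     tiles m N (Suc K) q \<inter> corridor i \<noteq> {}}"

definition gate :: "bool \<Rightarrow> nat \<Rightarrow> (real \<Rightarrow>\<^sub>C real) \<times> real" where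
  "gate b k = sheet m (s k) (contract (p k @ [a k]) (vertex (c b k)))"

definition portal_corner :: "bool \<Rightarrow> nat \<Rightarrow> bool \<Rightarrow> nat" where
  "portal_corner \<sigma> i b = (if s (station i b) = \<sigma> then a (station i b) else e i)"

text \<open>
The point where the path of leg $i$ on sheet \<open>\<sigma>\<close> begins or ends: a gate of a home, or the seam.
\<close>

definition portal :: "bool \<Rightarrow> nat \<Rightarrow> bool \<Rightarrow> (real \<Rightarrow>\<^sub>C real) \<times> real" where
  "portal \<sigma> i b = sheet m \<sigma> (contract (terminal \<sigma> i b) (vertex (portal_corner \<sigma> i b)))"

lemma gate_contact:
  assumes "k \<in> {1..n}"
  shows "contract (p k @ [a k]) (vertex (c b k)) = contract (p k @ [c b k]) (vertex (a k))"
    "tiles m N (Suc K) (gate b k) = {home k, (s k, p k @ [c b k])}" "gate b k \<in> double m N"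
proof -
  have w: "p k @ [a k] \<in> words N (Suc K)" "p k @ [c b k] \<in> words N (Suc K)"
    using p a c assms by (auto simp: snoc_in_words)
  note contact = cells_contact[of "a k" "c b k" "p k @ [a k]" "p k" 0 "p k @ [c b k]", OF _ _ _ w]
  show "contract (p k @ [a k]) (vertex (c b k)) = contract (p k @ [c b k]) (vertex (a k))"
    using contact(1) c(2)[OF assms, of b] by simp
  have g: "contract (p k @ [a k]) (vertex (c b k)) \<in> gasket N"
    using contract_vertex_in_cell[OF c(1)[OF assms]] cell_subset_gasket[OF w(1)] by blast
  have "contract (p k @ [a k]) (vertex (c b k)) \<notin> vertex ` {..<N}"
    using contact(3) c(2)[OF assms, of b] by simp
  then have "contract (p k @ [a k]) (vertex (c b k)) \<notin> vertex ` {..<m}" using mN by auto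
  moreover have "cells N (Suc K) (contract (p k @ [a k]) (vertex (c b k))) = {p k @ [a k], p k @ [c b k]}"
    using contact(2) c(2)[OF assms, of b] by simp
  ultimately show "tiles m N (Suc K) (gate b k) = {home k, (s k, p k @ [c b k])}"
    unfolding gate_def tiles_sheet[OF g mN] by (auto simp: home_def)
  show "gate b k \<in> double m N" using g by (auto simp: gate_def double_def)
qed

lemma portal_in_passage:
  assumes "i \<in> legs \<sigma>"
  shows "portal \<sigma> i b \<in> passage i"
    and "portal_corner \<sigma> i b < N"
    and "s (station i b) = \<sigma> \<Longrightarrow> portal \<sigma> i b = gate b (station i b)"
    and "s (station i b) \<noteq> \<sigma> \<Longrightarrow> portal \<sigma> i b = sheet m False (vertex (e i))"
proof -
  define k where "k = station i b"
  have i: "i \<in> {1..<n}" using assms by (simp add: legs_def)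
  have k: "k \<in> {1..n}" using station[OF i] by (simp add: k_def)
  have t: "(\<sigma>, terminal \<sigma> i b) \<in> corridor i" 
    using terminal_in_route[OF assms] assms by (simp add: corridor_def)
  have cross: "s i \<noteq> s (Suc i)" if "s k \<noteq> \<sigma>"
    using that assms by (auto simp: legs_def station_def k_def split: if_splits)
  show "portal_corner \<sigma> i b < N" using a[OF k] e[OF i cross] mN by (auto simp: portal_corner_def k_def[symmetric])
  show gate: "portal \<sigma> i b = gate b (station i b)" if "s (station i b) = \<sigma>"
    using that gate_contact(1)[OF k, of b] by (simp add: gate_def terminal_def portal_def portal_corner_def k_def)
  show seam: "portal \<sigma> i b = sheet m False (vertex (e i))" if "s (station i b) \<noteq> \<sigma>"
  proof -
    have "e i < m" using e[OF i] cross that by (simp add: k_def)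
    then have "sheet m \<sigma> (vertex (e i)) = sheet m False (vertex (e i))"
      using sheet_eq_iff[OF vertex_in_gasket mN] mN by simp
    then show ?thesis using that by (simp add: terminal_def portal_def portal_corner_def)
  qed
  show "portal \<sigma> i b \<in> passage i"
  proof (cases "s k = \<sigma>")
    case True
    have "home k \<in> {home i, home (Suc i)}" by (simp add: k_def station_def)
    then show ?thesis
      using gate True t gate_contact(2,3)[OF k, of b] by (auto simp: k_def[symmetric] passage_def terminal_def)
  next
    case False
    have em: "e i < m" using e[OF i cross[OF False]] .
    have legs: "i \<in> legs \<tau>" "\<exists>b. s (station i b) \<noteq> \<tau>" for \<tau>
    proof -
      have "s i = \<tau> \<or> s (Suc i) = \<tau>" "s i \<noteq> \<tau> \<or> s (Suc i) \<noteq> \<tau>" using cross[OF False] by auto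
      then show "i \<in> legs \<tau>" "\<exists>b. s (station i b) \<noteq> \<tau>"
        using i by (auto simp: legs_def station_def intro: exI[of _ True] exI[of _ False])
    qed
    have "(\<tau>, replicate (Suc K) (e i)) \<in> corridor i" for \<tau>
    proof -
      obtain b where "s (station i b) \<noteq> \<tau>" using legs(2) by blast
      then have "terminal \<tau> i b = replicate (Suc K) (e i)" by (simp add: terminal_def)
      then show ?thesis using terminal_in_route[OF legs(1), of \<tau> b] legs(1) by (simp add: corridor_def)
    qed
    then have corridor: "UNIV \<times> {replicate (Suc K) (e i)} \<subseteq> corridor i" 
      "UNIV \<times> {replicate (Suc K) (e i)} \<inter> corridor i \<noteq> {}" by blast+
    have "sheet m False (vertex (e i)) \<in> double m N"
      using vertex_in_gasket[of "e i" N] em mN by (auto simp: double_def)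
    then have "sheet m False (vertex (e i)) \<in> passage i"
      unfolding passage_def mem_Collect_eq tiles_vertex[OF em mN]
      by (intro conjI le_supI1 corridor)
    then show ?thesis using seam[folded k_def, OF False] by (simp only:)
  qed
qed

lemma passage_one_sheet:
  assumes "i \<in> legs \<sigma>"
  shows "path_component (passage i) (portal \<sigma> i False) (portal \<sigma> i True)"
proof -
  let ?A = "{f \<in> gasket N. cells N (Suc K) f \<subseteq> set (route \<sigma> i) \<and> f \<notin> vertex ` {..<N}}"
  let ?E = "\<lambda>b. contract (terminal \<sigma> i b) (vertex (portal_corner \<sigma> i b))"
  have "chain (words N (Suc K)) (terminal \<sigma> i False) (terminal \<sigma> i True) (route \<sigma> i)"
    using chain_mono[OF route(1)[OF assms]] by blast
  from chain_path[OF this portal_in_passage(2)[OF assms] portal_in_passage(2)[OF assms]]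
  have "path_component (sheet m \<sigma> ` (?A \<union> {?E False, ?E True})) (portal \<sigma> i False) (portal \<sigma> i True)"
    unfolding portal_def by (rule path_component_image) (rule continuous_on_sheet)
  moreover have "sheet m \<sigma> f \<in> passage i" if f: "f \<in> ?A" for f
  proof -
    have "f \<notin> vertex ` {..<m}" using f mN by auto
    then have t: "tiles m N (Suc K) (sheet m \<sigma> f) = {\<sigma>} \<times> cells N (Suc K) f"
      using tiles_sheet[of f N m "Suc K" \<sigma>] f mN by auto
    have "cells N (Suc K) f \<noteq> {}" using f gasket_eq_Union_cells[of N "Suc K"] by (auto simp: cells_def)
    moreover have sub: "{\<sigma>} \<times> cells N (Suc K) f \<subseteq> corridor i" using f assms by (auto simp: corridor_def)
    ultimately have ne: "{\<sigma>} \<times> cells N (Suc K) f \<inter> corridor i \<noteq> {}" by (simp add: Int_absorb2)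
    have "sheet m \<sigma> f \<in> double m N" using f by (auto simp: double_def)
    then show ?thesis
      unfolding passage_def mem_Collect_eq t by (intro conjI le_supI1 sub ne)
  qed
  ultimately show ?thesis
    using portal_in_passage(1)[OF assms] unfolding portal_def by (elim path_component_of_subset[rotated]) blast
qed

text \<open>
If the leg changes sheets, the paths on the two sheets have the seam in common.
\<close>

lemma passage_path:
  assumes i: "i \<in> {1..<n}"
  shows "path_component (passage i) (gate False i) (gate True (Suc i))"
proof -
  have st: "station i False = i" "station i True = Suc i" by (auto simp: station_def)
  have legs: "i \<in> legs (s i)" "i \<in> legs (s (Suc i))"
    using i st by (auto simp: legs_def intro: exI[of _ False] exI[of _ True])
  note g1 = portal_in_passage(3)[OF legs(1), of False, unfolded st]
  note g2 = portal_in_passage(3)[OF legs(2), of True, unfolded st]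
  show ?thesis
  proof (cases "s i = s (Suc i)")
    case True
    then show ?thesis using passage_one_sheet[OF legs(1)] g1 g2 by simp
  next
    case False
    then show ?thesis
      using passage_one_sheet[OF legs(1)] passage_one_sheet[OF legs(2)] g1 g2
       portal_in_passage(4)[OF legs(1), of True, unfolded st] portal_in_passage(4)[OF legs(2), of False, unfolded st]
      by (auto intro: path_component_trans)
  qed
qed

text \<open>
The part of the home of $x_k$ in which a path from a gate to $x_k$ is known to run.
\<close>

definition branch :: "bool \<Rightarrow> nat \<Rightarrow> ((real \<Rightarrow>\<^sub>C real) \<times> real) set" where
  "branch b k = (\<lambda>f. sheet m (s k) (contract (p k @ [a k]) f)) `
     {f \<in> gasket N. \<forall>i. i \<noteq> c b k \<longrightarrow> coord f i \<le> coord (h k) i}"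

lemma branch_path:
  assumes "k \<in> {1..n}"
  shows "path_component (branch b k) (gate b k) (x k)"
proof -
  have "continuous_on A (\<lambda>f. sheet m (s k) (contract (p k @ [a k]) f))" for A
    using continuous_on_compose2[OF continuous_on_sheet continuous_on_contract] by blast
  from path_component_image[OF path_from_vertex[OF c(1)[OF assms] h[OF assms]] this]
  show ?thesis unfolding branch_def gate_def x[OF assms] .
qed

text \<open>
A corner of the home whose coordinates other than \<open>c b k\<close> are bounded by those of $h_k$ is either
the corner \<open>c b k\<close> or $h_k$ itself.
\<close>

lemma branch_cases:
  assumes k: "k \<in> {1..n}" and q: "q \<in> branch b k"
  shows "q = gate b k \<or> q = x k \<or> tiles m N (Suc K) q = {home k}"
proof -
  let ?w = "p k @ [a k]"
  have w: "?w \<in> words N (Suc K)" using p a k by (simp add: snoc_in_words)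
  obtain f where f: "f \<in> gasket N" "\<And>i. i \<noteq> c b k \<Longrightarrow> coord f i \<le> coord (h k) i"
    "q = sheet m (s k) (contract ?w f)" using q by (auto simp: branch_def)
  show ?thesis
  proof (cases "f \<in> vertex ` {..<N}")
    case True
    then obtain d where d: "d < N" "f = vertex d" by auto
    show ?thesis
    proof (cases "d = c b k")
      case True
      then show ?thesis using f d by (simp add: gate_def)
    next
      case False
      then have "coord (h k) d \<ge> 1" using f(2)[of d] d by (simp add: coord_vertex)
      then have "h k = f" using gasket_vertexI[OF h[OF k] d(1)] d by simp
      then show ?thesis using f x[OF k] by simp
    qed
  next
    case False
    from cells_noncorner[OF f(1) w False] 
    have *: "cells N (Suc K) (contract ?w f) = {?w}" "contract ?w f \<notin> vertex ` {..<N}" .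
    have "contract ?w f \<in> gasket N" using f(1) cell_subset_gasket[OF w] by (auto simp: cell_def)
    moreover have "contract ?w f \<notin> vertex ` {..<m}" using *(2) mN by auto
    ultimately have "tiles m N (Suc K) q = {home k}" 
      unfolding f(3) home_def using tiles_sheet[of "contract ?w f" N m "Suc K" "s k"] *(1) mN by auto
    then show ?thesis by simp
  qed
qed

text \<open>
On the intersection, every coordinate is bounded by that of $h_k$.
\<close>

lemma branches_meet:
  assumes k: "k \<in> {1..n}" and q: "q \<in> branch False k" "q \<in> branch True k"
  shows "q = x k"
proof -
  obtain f where f: "f \<in> gasket N" "\<And>i. i \<noteq> c False k \<Longrightarrow> coord f i \<le> coord (h k) i"
    "q = sheet m (s k) (contract (p k @ [a k]) f)" using q(1) by (auto simp: branch_def)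
  obtain g where g: "g \<in> gasket N" "\<And>i. i \<noteq> c True k \<Longrightarrow> coord g i \<le> coord (h k) i"
    "q = sheet m (s k) (contract (p k @ [a k]) g)" using q(2) by (auto simp: branch_def)
  have "contract (p k @ [a k]) f = contract (p k @ [a k]) g" using f(3) g(3) by (metis fst_sheet)
  then have "f = g" by (simp only: contract_eq_iff)
  then have "coord f i \<le> coord (h k) i" for i using f(2) g(2) c_distinct[OF k] by metis
  then have "f = h k" using gasket_eqI f(1) h[OF k] by blast
  then show ?thesis using f(3) x[OF k] by simp
qed

definition strip :: "nat \<Rightarrow> ((real \<Rightarrow>\<^sub>C real) \<times> real) set" where
  "strip i = branch False i \<union> passage i \<union> branch True (Suc i)"

lemma strip_path:
  assumes "i \<in> {1..<n}"
  shows "path_component (strip i) (x i) (x (Suc i))"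
proof -
  have "path_component (strip i) (x i) (gate False i)" 
    using path_component_sym[OF branch_path[of i False]] assms by (auto simp: strip_def elim!: path_component_of_subset[rotated])
  moreover have "path_component (strip i) (gate False i) (gate True (Suc i))"
    using passage_path[OF assms] by (auto simp: strip_def elim!: path_component_of_subset[rotated])
  moreover have "path_component (strip i) (gate True (Suc i)) (x (Suc i))"
    using branch_path[of "Suc i" True] assms by (auto simp: strip_def elim!: path_component_of_subset[rotated])
  ultimately show ?thesis by (meson path_component_trans)
qed

text \<open>
The points of a strip outside its passage remember the home to which they belong.
\<close>

definition near :: "nat \<Rightarrow> (real \<Rightarrow>\<^sub>C real) \<times> real \<Rightarrow> bool" where
  "near k q \<longleftrightarrow> q = x k \<or> tiles m N (Suc K) q = {home k}"

lemma strip_cases: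
  assumes i: "i \<in> {1..<n}" and q: "q \<in> strip i"
  shows "q \<in> passage i \<or> (q \<in> branch False i \<and> near i q) \<or> (q \<in> branch True (Suc i) \<and> near (Suc i) q)"
proof -
  have "gate False i \<in> passage i" "gate True (Suc i) \<in> passage i"
    using passage_path[OF i] path_component_mem by blast+
  then show ?thesis
    using q branch_cases[of i q False] branch_cases[of "Suc i" q True] i
    by (auto simp: strip_def near_def)
qed

lemma near_inj: 
  assumes "k \<in> {1..n}" "l \<in> {1..n}" "near k q" "near l q"
  shows "k = l"
proof -
  have "home k \<in> tiles m N (Suc K) q" "home l \<in> tiles m N (Suc K) q"
    using assms home_in_tiles by (auto simp: near_def)
  then have "home k = home l \<or> q = x k \<or> q = x l" using assms by (auto simp: near_def)
  then show ?thesis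
    using separated_fine home_in_tiles assms \<open>home k \<in> _\<close> \<open>home l \<in> _\<close> by metis
qed

lemma near_not_passage:
  assumes "k \<in> {1..n}" "near k q"
  shows "q \<notin> passage i"
proof -
  have "tiles m N (Suc K) q \<subseteq> tiles m N (Suc K) (x k)" 
    using assms home_in_tiles by (auto simp: near_def)
  then have "tiles m N (Suc K) q \<inter> corridor i = {}" using corridor_avoids[OF assms(1)] by blast
  then show ?thesis by (simp add: passage_def)
qed

lemma passage_disjoint:
  assumes "i \<in> {1..<n}" "k \<in> {1..<n}" "i \<noteq> k"
  shows "passage i \<inter> passage k = {}"
proof -
  have "home k \<notin> corridor i" "home (Suc k) \<notin> corridor i"
    using corridor_avoids[of k i] corridor_avoids[of "Suc k" i] home_in_tiles[of k] home_in_tiles[of "Suc k"] assms(2)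
    by auto
  then show ?thesis using corridor_disjoint[OF assms(3)] unfolding passage_def by blast
qed

lemma strips_meet:
  assumes ik: "i \<in> {1..<n}" "k \<in> {1..<n}" "i < k"
  shows "strip i \<inter> strip k \<subseteq> (if k = Suc i then {x k} else {})"
proof
  fix q assume q: "q \<in> strip i \<inter> strip k"
  have "q \<notin> passage i \<or> q \<notin> passage k" using passage_disjoint ik by blast
  moreover have near_st: "l \<in> {1..n}" if "l \<in> {i, Suc i, k, Suc k}" for l using that ik by auto
  ultimately have "(q \<in> branch False i \<and> near i q) \<or> (q \<in> branch True (Suc i) \<and> near (Suc i) q)"
    "(q \<in> branch False k \<and> near k q) \<or> (q \<in> branch True (Suc k) \<and> near (Suc k) q)"
    using strip_cases[OF ik(1), of q] strip_cases[OF ik(2), of q] q near_not_passage near_st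
    by (metis IntD1 IntD2 insertCI)+
  then have "k = Suc i \<and> q \<in> branch False k \<and> q \<in> branch True k"
    using near_inj near_st ik(3) by (metis Suc_inject insertCI less_irrefl_nat not_less_eq less_SucI)
  then show "q \<in> (if k = Suc i then {x k} else {})" using branches_meet[of k q] ik by auto
qed

lemma strip_subset: "i \<in> {1..<n} \<Longrightarrow> strip i \<subseteq> double m N"
proof -
  have "branch b k \<subseteq> double m N" if "k \<in> {1..n}" for b k
    using cell_subset_gasket[of "p k @ [a k]" N "Suc K"] p[OF that] a[OF that]
    by (auto simp: branch_def double_def cell_def snoc_in_words)
  then show ?thesis if "i \<in> {1..<n}" using that by (auto simp: strip_def passage_def)
qed

lemma arc_through_points:
  "\<exists>g t. arc g \<and> path_image g \<subseteq> double m N \<and> t \<in> {1..n} \<rightarrow> {0..1} \<and> 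
     strict_mono_on {1..n} t \<and> (\<forall>i\<in>{1..n}. g (t i) = x i)"
proof -
  have "\<exists>H. arc H \<and> path_image H \<subseteq> strip i \<and> pathstart H = x i \<and> pathfinish H = x (Suc i)"
    if i: "i \<in> {1..<n}" for i
  proof -
    have ne: "x i \<noteq> x (Suc i)" 
    proof
      assume eq: "x i = x (Suc i)"
      have st: "i \<in> {1..n}" "Suc i \<in> {1..n}" using i by auto
      have "i = Suc i" 
        using separated_fine[OF st home_in_tiles[OF st(1)]] home_in_tiles[OF st(1)] eq by simp
      then show False by simp
    qed
    obtain g where g: "path g" "path_image g \<subseteq> strip i" "pathstart g = x i" "pathfinish g = x (Suc i)"
      using strip_path[OF i] unfolding path_component_def by blast
    obtain H where "arc H" "path_image H \<subseteq> path_image g" "pathstart H = x i" "pathfinish H = x (Suc i)"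
      by (rule path_contains_arc[OF g(1,3,4) ne])
    then show ?thesis using g(2) by blast
  qed
  then obtain H where H: "\<And>i. i \<in> {1..<n} \<Longrightarrow> arc (H i) \<and> path_image (H i) \<subseteq> strip i \<and> pathstart (H i) = x i \<and> pathfinish (H i) = x (Suc i)"
    by metis
  have "\<exists>g t. arc g \<and> path_image g \<subseteq> (\<Union>i\<in>{1..<n}. path_image (H i)) \<and> 
    t \<in> {1..n} \<rightarrow> {0..1} \<and> strict_mono_on {1..n} t \<and> (\<forall>i\<in>{1..n}. g (t i) = x i) \<and> t n = (1::real)"
  proof (rule concatenate_arcs[OF n2])
    show "path_image (H i) \<inter> path_image (H k) \<subseteq> (if k = Suc i then {x k} else {})"
      if "i \<in> {1..<n}" "k \<in> {1..<n}" "i < k" for i k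
      using strips_meet[OF that] H[OF that(1)] H[OF that(2)] by blast
  qed (use H in auto)
  moreover have "(\<Union>i\<in>{1..<n}. path_image (H i)) \<subseteq> double m N" using H strip_subset by blast
  ultimately show ?thesis by (meson order_trans)
qed

end

section \<open>The double gasket is strongly arc connected\<close>

text \<open>
The indices in $F$ may take either value. Let each of them copy its predecessor, and an initial
segment of $F$ the first value after it. Then a change happens only upon arrival at an index outside
$F$, and not at the first of these.
\<close>

lemma few_side_changes:
  fixes s\<^sub>0 :: "nat \<Rightarrow> bool"
  assumes "\<not> {1..n} \<subseteq> F"
  shows "\<exists>s. (\<forall>i\<in>{1..n} - F. s i = s\<^sub>0 i) \<and> 
    card {i \<in> {1..<n}. s i \<noteq> s (Suc i)} + card (F \<inter> {1..n}) < n"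
  using assms
proof (induction n)
  case (Suc n)
  show ?case
  proof (cases "{1..n} \<subseteq> F")
    case True
    then have "Suc n \<notin> F" using Suc.prems by (auto simp: atLeastAtMostSuc_conv)
    then have "F \<inter> {1..Suc n} = {1..n}" using True by (auto simp: atLeastAtMostSuc_conv)
    moreover have "\<forall>i\<in>{1..Suc n} - F. s\<^sub>0 (Suc n) = s\<^sub>0 i" 
      using True by (auto simp: atLeastAtMostSuc_conv)
    ultimately show ?thesis by (intro exI[of _ "\<lambda>i. s\<^sub>0 (Suc n)"]) simp
  next
    case False
    then obtain s where s: "\<And>i. i \<in> {1..n} - F \<Longrightarrow> s i = s\<^sub>0 i"
      "card {i \<in> {1..<n}. s i \<noteq> s (Suc i)} + card (F \<inter> {1..n}) < n"
      using Suc.IH by blast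
    \<comment> \<open>A new index in $F$ copies its predecessor; another new index causes at most one change.\<close>
    define s' where "s' = s(Suc n := if Suc n \<in> F then s n else s\<^sub>0 (Suc n))"
    have "\<forall>i\<in>{1..Suc n} - F. s' i = s\<^sub>0 i" using s(1) by (auto simp: s'_def)
    moreover have "card {i \<in> {1..<Suc n}. s' i \<noteq> s' (Suc i)} + card (F \<inter> {1..Suc n}) < Suc n"
    proof -
      have sub: "{i \<in> {1..<Suc n}. s' i \<noteq> s' (Suc i)} \<subseteq> 
          {i \<in> {1..<n}. s i \<noteq> s (Suc i)} \<union> (if Suc n \<in> F then {} else {n})"
        by (auto simp: s'_def)
      have "card {i \<in> {1..<Suc n}. s' i \<noteq> s' (Suc i)} \<le> 
          card ({i \<in> {1..<n}. s i \<noteq> s (Suc i)} \<union> (if Suc n \<in> F then {} else {n}))"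
        by (rule card_mono[OF _ sub]) simp
      also have "\<dots> \<le> card {i \<in> {1..<n}. s i \<noteq> s (Suc i)} + (if Suc n \<in> F then 0 else 1)"
        by (rule order_trans[OF card_Un_le]) simp
      finally have "card {i \<in> {1..<Suc n}. s' i \<noteq> s' (Suc i)} \<le> 
          card {i \<in> {1..<n}. s i \<noteq> s (Suc i)} + (if Suc n \<in> F then 0 else 1)" .
      moreover have "F \<inter> {1..Suc n} = (if Suc n \<in> F then insert (Suc n) (F \<inter> {1..n}) else F \<inter> {1..n})"
        by (auto simp: atLeastAtMostSuc_conv)
      then have "card (F \<inter> {1..Suc n}) = card (F \<inter> {1..n}) + (if Suc n \<in> F then 1 else 0)" by simp
      ultimately show ?thesis using s(2) by (auto split: if_splits)
    qed
    ultimately show ?thesis by blast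
  qed
qed simp

text \<open>
Different points above the same point of the gasket lie on different sheets, off the seams, and have no tile
in common; for other points the diameter of the tiles decides.
\<close>

lemma tiles_separate_two:
  assumes "q \<noteq> r"
  shows "\<exists>K0. \<forall>K\<ge>K0. tiles m N K q \<inter> tiles m N K r = {}"
proof -
  obtain D where D: "0 \<le> D" "\<And>w f g. f \<in> cell N w \<Longrightarrow> g \<in> cell N w \<Longrightarrow> dist f g \<le> D * (1/2) ^ length w"
    using dist_cell_bounded by blast
  have common: "fst q \<noteq> fst r \<and> dist (fst q) (fst r) \<le> D * (1/2) ^ K" 
    if "(s, w) \<in> tiles m N K q" "(s, w) \<in> tiles m N K r" for s w K
  proof -
    obtain f g where fg: "f \<in> cell N w" "q = sheet m s f" "g \<in> cell N w" "r = sheet m s g" "w \<in> words N K"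
      using \<open>(s, w) \<in> tiles m N K q\<close> \<open>(s, w) \<in> tiles m N K r\<close> by (auto simp: tiles_def)
    then show ?thesis using D(2)[OF fg(1,3)] assms by (auto simp: words_def)
  qed
  show ?thesis
  proof (cases "fst q = fst r")
    case True
    then show ?thesis using common by fastforce
  next
    case False
    then have "dist (fst q) (fst r) > 0" by simp
    then obtain K0 where K0: "D * (1/2) ^ K0 < dist (fst q) (fst r)"
      using LIMSEQ_D[OF tendsto_mult_right_zero[OF LIMSEQ_realpow_zero[of "1/2"]], of "dist (fst q) (fst r)" D] D(1) by auto
    have "tiles m N K q \<inter> tiles m N K r = {}" if "K0 \<le> K" for K
    proof (rule ccontr)
      assume "tiles m N K q \<inter> tiles m N K r \<noteq> {}"
      then obtain s w where "(s, w) \<in> tiles m N K q" "(s, w) \<in> tiles m N K r" by auto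
      then have "dist (fst q) (fst r) \<le> D * (1/2) ^ K" using common by blast
      also have "\<dots> \<le> D * (1/2) ^ K0" using D(1) that by (intro mult_left_mono power_decreasing) auto
      finally show False using K0 by simp
    qed
    then show ?thesis by blast
  qed
qed

lemma tiles_separate:
  assumes "finite A"
  shows "\<exists>K. \<forall>q\<in>A. \<forall>r\<in>A. q \<noteq> r \<longrightarrow> tiles m N K q \<inter> tiles m N K r = {}"
proof -
  have "\<forall>q r. \<exists>K0. q \<noteq> r \<longrightarrow> (\<forall>K\<ge>K0. tiles m N K q \<inter> tiles m N K r = {})"
    using tiles_separate_two by blast
  then obtain K0 where K0: "\<And>q r K. q \<noteq> r \<Longrightarrow> K0 q r \<le> K \<Longrightarrow> tiles m N K q \<inter> tiles m N K r = {}"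
    by metis
  define K where "K = Max (insert 0 ((\<lambda>(q, r). K0 q r) ` (A \<times> A)))"
  have "K0 q r \<le> K" if "q \<in> A" "r \<in> A" for q r
    unfolding K_def using assms that by (intro Max_ge) auto
  then show ?thesis using K0 by blast
qed

text \<open>
The point lies in at most two cells, so at most three letters are excluded.
\<close>

lemma fresh_letters:
  assumes "5 \<le> N" "a < N" 
  obtains c :: "bool \<Rightarrow> nat" where "\<And>b. c b < N" "\<And>b. c b \<noteq> a" "c False \<noteq> c True" 
    "\<And>b. p @ [c b] \<notin> cells N L f"
proof -
  define B where "B = {b. p @ [b] \<in> cells N L f}"
  have fin: "finite (cells N L f)"
    using finite_words by (auto simp: cells_def intro: rev_finite_subset)
  have "inj_on (\<lambda>b. p @ [b]) B" by (simp add: inj_on_def)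
  moreover have "(\<lambda>b. p @ [b]) ` B \<subseteq> cells N L f" by (auto simp: B_def)
  ultimately have B: "finite B" "card B \<le> card (cells N L f)"
    using fin card_inj_on_le inj_on_finite by blast+
  then have "card B \<le> 2" using card_cells_le_2 order_trans by blast
  then have "card (insert a B) \<le> 3" using card_insert_le_m1[of 3 B a] by simp
  then have "2 \<le> card ({..<N} - insert a B)"
    using diff_card_le_card_Diff[of "insert a B" "{..<N}"] B(1) assms(1) by simp
  then obtain T where T: "T \<subseteq> {..<N} - insert a B" "card T = 2"
    using obtain_subset_with_card_n by metis
  then obtain u v where "T = {u, v}" "u \<noteq> v" by (auto simp: card_2_iff)
  then show ?thesis
    using T(1) that[of "\<lambda>b. if b then v else u"] by (auto simp: B_def split: if_splits)
qed

text \<open>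
It remains to choose an itinerary. The points that are seams are assigned to sheets by
\<open>few_side_changes\<close>, which leaves at least as many unused seams as there are changes of sheet.
\<close>

lemma strongly_arc_connected_double:
  assumes "0 < m" "9 * (m + 1) \<le> N"
  shows "strongly_arc_connected (m + 1) (top_of_set (double m N))"
  unfolding strongly_arc_connected_def
proof (intro allI impI)
  define n where "n = m + 1"
  have mN: "m \<le> N" using assms(2) by simp
  fix x :: "nat \<Rightarrow> (real \<Rightarrow>\<^sub>C real) \<times> real"
  assume "x \<in> {1..m + 1} \<rightarrow> topspace (top_of_set (double m N)) \<and> inj_on x {1..m + 1}"
  then have x: "\<And>k. k \<in> {1..n} \<Longrightarrow> x k \<in> double m N" and inj: "inj_on x {1..n}"
    by (auto simp: n_def Pi_iff)
  define seam where "seam j = sheet m False (vertex j)" for j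
  have seam: "seam j = sheet m \<sigma> (vertex j)" if "j < m" for j \<sigma>
    using sheet_eq_iff[OF vertex_in_gasket mN, of j False \<sigma>] that mN by (simp add: seam_def)
  have seam_inj: "inj seam" by (metis fst_sheet injI seam_def vertex_inject)
  \<comment> \<open>\<open>F\<close> collects the points that are seams, \<open>Free\<close> the seams that are available for crossings.\<close>
  define F where "F = {k \<in> {1..n}. x k \<in> seam ` {..<m}}"
  define Free where "Free = {j \<in> {..<m}. seam j \<notin> x ` {1..n}}"
  have cardF: "card F + card Free = m"
  proof -
    have sub: "Free \<subseteq> {..<m}" by (auto simp: Free_def)
    have hit: "seam j \<in> x ` {1..n} \<longleftrightarrow> j \<notin> Free" if "j < m" for j
      using that by (simp add: Free_def)
    have "x ` F = seam ` ({..<m} - Free)"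
    proof (intro equalityI subsetI)
      fix q assume "q \<in> x ` F"
      then obtain k j where kj: "k \<in> {1..n}" "j < m" "q = x k" "x k = seam j"
        unfolding F_def by blast
      then have "seam j \<in> x ` {1..n}" by (metis imageI)
      then have "j \<in> {..<m} - Free" using hit kj(2) by simp
      then show "q \<in> seam ` ({..<m} - Free)" using kj by simp
    next
      fix q assume "q \<in> seam ` ({..<m} - Free)"
      then obtain j where j: "j < m" "j \<notin> Free" "q = seam j" by blast
      then obtain k where k: "k \<in> {1..n}" "seam j = x k" using hit by blast
      then have "k \<in> F" unfolding F_def using j(1) by (metis (mono_tags, lifting) imageI lessThan_iff mem_Collect_eq)
      then show "q \<in> x ` F" using j(3) k(2) by simp
    qed
    then have "card F = card ({..<m} - Free)"
      using card_image[of x F] card_image[of seam "{..<m} - Free"] inj seam_inj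
      by (metis (no_types, lifting) F_def inj_on_subset mem_Collect_eq subsetI subset_UNIV)
    also have "\<dots> = m - card Free" 
      using card_Diff_subset[OF finite_subset[OF sub] sub] by simp
    finally show ?thesis using card_mono[OF _ sub] by simp
  qed
  have "\<not> {1..n} \<subseteq> F"
  proof
    assume "{1..n} \<subseteq> F"
    then have "n \<le> card F" using card_mono[of F "{1..n}"] by (simp add: F_def)
    then show False using cardF by (simp add: n_def)
  qed
  have "\<forall>k. \<exists>\<sigma>. k \<in> {1..n} \<longrightarrow> x k \<in> sheet m \<sigma> ` gasket N"
    using x by (auto simp: double_def)
  then obtain s\<^sub>0 where s\<^sub>0: "\<And>k. k \<in> {1..n} \<Longrightarrow> x k \<in> sheet m (s\<^sub>0 k) ` gasket N" by metis
  obtain s where s: "\<And>k. k \<in> {1..n} - F \<Longrightarrow> s k = s\<^sub>0 k"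
    and few: "card {i \<in> {1..<n}. s i \<noteq> s (Suc i)} + card (F \<inter> {1..n}) < n"
    using few_side_changes[OF \<open>\<not> {1..n} \<subseteq> F\<close>, of s\<^sub>0] by blast
  have side: "x k \<in> sheet m (s k) ` gasket N" if k: "k \<in> {1..n}" for k
  proof (cases "k \<in> F")
    case True
    then obtain j where "j < m" "x k = seam j" by (auto simp: F_def)
    then show ?thesis using seam[of j "s k"] vertex_in_gasket[of j N] mN by auto
  next
    case False
    then show ?thesis using s s\<^sub>0 k by auto
  qed
  define C where "C = {i \<in> {1..<n}. s i \<noteq> s (Suc i)}"
  have "F \<inter> {1..n} = F" by (auto simp: F_def)
  then have "card C \<le> card Free" using few cardF by (simp add: C_def n_def)
  moreover have "finite C" "finite Free" by (simp_all add: C_def Free_def)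
  ultimately obtain e where e: "e ` C \<subseteq> Free" "inj_on e C" using card_le_inj by metis
  \<comment> \<open>From level $K$ on, no tile contains two of the points and seams.\<close>
  define A where "A = x ` {1..n} \<union> seam ` {..<m}"
  have "finite A" by (simp add: A_def)
  obtain K where K: "\<And>q r. q \<in> A \<Longrightarrow> r \<in> A \<Longrightarrow> q \<noteq> r \<Longrightarrow> tiles m N K q \<inter> tiles m N K r = {}"
    using tiles_separate[OF \<open>finite A\<close>, of m N] by blast
  have "\<exists>p a h c. p \<in> words N K \<and> a < N \<and> h \<in> gasket N \<and> x k = sheet m (s k) (contract (p @ [a]) h) \<and>
      (\<forall>b. c b < N \<and> c b \<noteq> a \<and> (s k, p @ [c b]) \<notin> tiles m N (Suc K) (x k)) \<and> c False \<noteq> c True"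
    if k: "k \<in> {1..n}" for k
  proof -
    obtain f where f: "f \<in> gasket N" "x k = sheet m (s k) f" using side[OF k] by auto
    then obtain w where w: "w \<in> words N (Suc K)" "f \<in> cell N w"
      using gasket_eq_Union_cells[of N "Suc K"] by auto
    obtain p a where pa: "w = p @ [a]" using w(1) by (cases w rule: rev_cases) (auto simp: words_def)
    have paN: "p \<in> words N K" "a < N" using w(1) by (simp_all add: pa snoc_in_words)
    obtain h where h: "h \<in> gasket N" "f = contract w h" using w(2) by (auto simp: cell_def)
    obtain c where c: "\<And>b. c b < N" "\<And>b. c b \<noteq> a" "c False \<noteq> c True" "\<And>b. p @ [c b] \<notin> cells N (Suc K) f"
      using fresh_letters[of N a p "Suc K" f] assms paN by auto
    have "(s k, p @ [c b]) \<notin> tiles m N (Suc K) (x k)" for b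
      using c(4)[of b] unfolding f(2) tiles_sheet[OF f(1) mN] by blast
    then show ?thesis using c paN h f(2) unfolding pa by blast
  qed
  then have "\<forall>k. \<exists>p a h c. k \<in> {1..n} \<longrightarrow> p \<in> words N K \<and> a < N \<and> h \<in> gasket N \<and> x k = sheet m (s k) (contract (p @ [a]) h) \<and>
      (\<forall>b. c b < N \<and> c b \<noteq> a \<and> (s k, p @ [c b]) \<notin> tiles m N (Suc K) (x k)) \<and> c False \<noteq> c True"
    by blast
  then obtain p a h c where pahc: "\<And>k. k \<in> {1..n} \<Longrightarrow> p k \<in> words N K \<and> a k < N \<and> h k \<in> gasket N \<and> 
      x k = sheet m (s k) (contract (p k @ [a k]) (h k)) \<and>
      (\<forall>b. c k b < N \<and> c k b \<noteq> a k \<and> (s k, p k @ [c k b]) \<notin> tiles m N (Suc K) (x k)) \<and> c k False \<noteq> c k True"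
    by metis
  interpret itinerary m N n K x s p a h "\<lambda>b k. c k b" e
  proof
    fix i k assume i: "i \<in> {1..<n}" "s i \<noteq> s (Suc i)"
    then have ei: "e i \<in> Free" using e(1) by (auto simp: C_def)
    then show "e i < m" by (simp add: Free_def)
    assume k: "k \<in> {1..n}"
    show "tiles m N K (x k) \<inter> tiles m N K (sheet m False (vertex (e i))) = {}"
      unfolding seam_def[symmetric]
    proof (rule K)
      show "x k \<in> A" "seam (e i) \<in> A" using ei k by (simp_all add: A_def Free_def)
      show "x k \<noteq> seam (e i)" using ei k by (metis (mono_tags, lifting) Free_def imageI mem_Collect_eq)
    qed
  next
    fix k l assume kl: "k \<in> {1..n}" "l \<in> {1..n}" "k \<noteq> l"
    then have "x k \<noteq> x l" using inj by (auto dest: inj_onD)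
    then show "tiles m N K (x k) \<inter> tiles m N K (x l) = {}" using kl by (intro K) (simp_all add: A_def)
  next
    fix k assume k: "k \<in> {1..n}"
    show "p k \<in> words N K" "a k < N" "h k \<in> gasket N" "c k False \<noteq> c k True"
      "x k = sheet m (s k) (contract (p k @ [a k]) (h k))"
      using pahc[OF k] by blast+
    show "c k b < N" "c k b \<noteq> a k" "(s k, p k @ [c k b]) \<notin> tiles m N (Suc K) (x k)" for b
      using pahc[OF k] by blast+
  qed (use mN assms e(2) in \<open>simp_all add: n_def C_def\<close>)
  show "\<exists>\<alpha> t. arc_in (top_of_set (double m N)) \<alpha> \<and> t \<in> {1..m + 1} \<rightarrow> {0..1} \<and>
     strict_mono_on {1..m + 1} t \<and> (\<forall>i\<in>{1..m + 1}. \<alpha> (t i) = x i)"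
    using arc_through_points arc_in_subspaceI unfolding n_def by blast
qed

section \<open>Transport along homeomorphisms\<close>

lemma regular_continuum_homeomorphic:
  assumes "homeomorphic_map (mtopology_of m) (mtopology_of m') \<phi>" "regular_continuum m"
  shows "regular_continuum m'"
proof -
  let ?X = "mtopology_of m" and ?Y = "mtopology_of m'"
  obtain \<B> where \<B>: "\<forall>V\<in>\<B>. openin ?X V"
      "\<And>U x. openin ?X U \<Longrightarrow> x \<in> U \<Longrightarrow> \<exists>V\<in>\<B>. x \<in> V \<and> V \<subseteq> U"
      "\<forall>V\<in>\<B>. finite (?X frontier_of V)" 
    and cont: "compact_space ?X" "connected_space ?X"
    using assms(2) unfolding regular_continuum_def continuum_def by metis
  have hs: "?X homeomorphic_space ?Y" using assms(1) homeomorphic_map_imp_homeomorphic_space by blast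
  have op: "openin ?Y (\<phi> ` V) \<longleftrightarrow> openin ?X V" if "V \<subseteq> topspace ?X" for V
    using homeomorphic_map_openness[OF assms(1) that] .
  have sub: "V \<subseteq> topspace ?X" if "V \<in> \<B>" for V using \<B>(1) that openin_subset by blast
  have surj: "\<phi> ` topspace ?X = topspace ?Y" using assms(1) homeomorphic_imp_surjective_map by blast
  have "\<exists>W\<in>(`) \<phi> ` \<B>. y \<in> W \<and> W \<subseteq> U" if U: "openin ?Y U" "y \<in> U" for U y
  proof -
    define U' where "U' = {x \<in> topspace ?X. \<phi> x \<in> U}"
    have U': "openin ?X U'" 
      unfolding U'_def using U(1) assms(1) homeomorphic_imp_continuous_map openin_continuous_map_preimage by blast
    have "y \<in> \<phi> ` topspace ?X" unfolding surj using U openin_subset by blast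
    then obtain x where "x \<in> topspace ?X" and y: "y = \<phi> x" by blast
    then have x: "x \<in> U'" using U(2) by (simp add: U'_def)
    obtain V where "V \<in> \<B>" "x \<in> V" "V \<subseteq> U'" using \<B>(2)[OF U' x] by blast
    then show ?thesis using y by (auto simp: U'_def)
  qed
  moreover have "finite (?Y frontier_of (\<phi> ` V))" if "V \<in> \<B>" for V
    using homeomorphic_map_frontier_of[OF assms(1) sub[OF that]] \<B>(3) that by simp
  moreover have "compact_space ?Y" "connected_space ?Y"
    using cont hs homeomorphic_compact_space homeomorphic_connected_space by blast+
  ultimately show ?thesis
    unfolding regular_continuum_def continuum_def using op sub \<B>(1)
    by (intro conjI exI[of _ "(`) \<phi> ` \<B>"]) auto
qed

lemma strongly_arc_connected_homeomorphic:
  assumes "homeomorphic_map X Y \<phi>" "strongly_arc_connected n X"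
  shows "strongly_arc_connected n Y"
  unfolding strongly_arc_connected_def
proof (intro allI impI)
  fix y assume y: "y \<in> {1..n} \<rightarrow> topspace Y \<and> inj_on y {1..n}"
  obtain \<psi> where \<psi>: "homeomorphic_maps X Y \<phi> \<psi>" using assms(1) homeomorphic_map_maps by metis
  then have inv: "\<And>z. z \<in> topspace Y \<Longrightarrow> \<psi> z \<in> topspace X \<and> \<phi> (\<psi> z) = z"
    by (auto simp: homeomorphic_maps_def continuous_map_def)
  have yY: "y i \<in> topspace Y" if "i \<in> {1..n}" for i using y that by blast
  have "\<psi> \<circ> y \<in> {1..n} \<rightarrow> topspace X" using inv[OF yY] by simp
  moreover have "inj_on (\<psi> \<circ> y) {1..n}"
  proof (rule inj_onI)
    fix i k assume ik: "i \<in> {1..n}" "k \<in> {1..n}" "(\<psi> \<circ> y) i = (\<psi> \<circ> y) k"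
    then have "y i = y k" using inv[OF yY[OF ik(1)]] inv[OF yY[OF ik(2)]] by (metis comp_apply)
    then show "i = k" using y ik by (auto dest: inj_onD)
  qed
  ultimately obtain \<alpha> t where \<alpha>: "arc_in X \<alpha>" and t: "t \<in> {1..n} \<rightarrow> {0..1}" "strict_mono_on {1..n} t"
      "\<forall>i\<in>{1..n}. \<alpha> (t i) = (\<psi> \<circ> y) i"
    using assms(2)[unfolded strongly_arc_connected_def, rule_format, of "\<psi> \<circ> y"] by blast
  have "embedding_map X Y \<phi>"
    using assms(1) homeomorphic_imp_surjective_map unfolding embedding_map_def by fastforce
  then have "arc_in Y (\<phi> \<circ> \<alpha>)"
    using \<alpha> unfolding arc_in_def by (rule embedding_map_compose[rotated])
  moreover have "\<forall>i\<in>{1..n}. (\<phi> \<circ> \<alpha>) (t i) = y i"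
    using t(3) inv[OF yY] by simp
  ultimately show "\<exists>\<alpha> t. arc_in Y \<alpha> \<and> t \<in> {1..n} \<rightarrow> {0..1} \<and> strict_mono_on {1..n} t \<and>
      (\<forall>i\<in>{1..n}. \<alpha> (t i) = y i)"
    using t by blast
qed

lemma transported_metric:
  fixes m :: "'a metric" and \<phi> :: "'a \<Rightarrow> 'b"
  assumes "inj_on \<phi> (mspace m)"
  obtains m' where "homeomorphic_map (mtopology_of m) (mtopology_of m') \<phi>"
proof -
  let ?\<psi> = "inv_into (mspace m) \<phi>"
  let ?d = "\<lambda>u v. mdist m (?\<psi> u) (?\<psi> v)"
  have M: "Metric_space (\<phi> ` mspace m) ?d"
  proof
    show "0 \<le> ?d u v" for u v by simp
    show "?d u v = ?d v u" for u v by (simp add: mdist_commute)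
    show "?d u v = 0 \<longleftrightarrow> u = v" if "u \<in> \<phi> ` mspace m" "v \<in> \<phi> ` mspace m" for u v
      using that by (metis f_inv_into_f inv_into_into mdist_zero)
    show "?d u w \<le> ?d u v + ?d v w" 
      if "u \<in> \<phi> ` mspace m" "v \<in> \<phi> ` mspace m" "w \<in> \<phi> ` mspace m" for u v w
      using that by (metis inv_into_into mdist_triangle)
  qed
  interpret Metric_space12 "mspace m" "mdist m" "\<phi> ` mspace m" ?d
    using M by (simp add: Metric_space12_def)
  have "homeomorphic_map M1.mtopology M2.mtopology \<phi>"
    by (rule isometry_imp_homeomorphic_map) (use assms in \<open>simp_all add: inv_into_f_f\<close>)
  then have "homeomorphic_map (mtopology_of m) (mtopology_of (metric (\<phi> ` mspace m, ?d))) \<phi>"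
    unfolding M2.mtopology_of by (simp only: mtopology_of_def)
  then show ?thesis by (rule that)
qed

section \<open>The example\<close>

(* Every compact metric space embeds in a countable power of the real line, so taking
   carriers inside "nat \<Rightarrow> real" (with an arbitrary metric) loses no generality. *)
theorem theorem10:
  fixes n :: nat
  assumes "n \<ge> 2"
  shows "\<exists>m :: (nat \<Rightarrow> real) metric. regular_continuum m \<and>
           strongly_arc_connected n (mtopology_of m) \<and>
           \<not> strongly_arc_connected (n + 1) (mtopology_of m)"
proof -
  define m N where "m = n - 1" and "N = 9 * n"
  have m: "0 < m" "m \<le> N" "9 * (m + 1) \<le> N" "2 * m + 2 \<le> N" "m + 1 = n" "m + 2 = n + 1"
    using assms by (auto simp: m_def N_def)
  define X where "X = double m N"
  define d where "d = submetric euclidean_metric X"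
  have top: "mtopology_of d = top_of_set X" by (simp add: d_def mtopology_of_submetric)
  have regular: "regular_continuum d"
    unfolding regular_continuum_def continuum_def top
  proof (intro conjI exI[of _ "{V. openin (top_of_set X) V \<and> finite (top_of_set X frontier_of V)}"])
    show "compact_space (top_of_set X)" 
      using compact_double by (simp add: X_def compact_space_subtopology compactin_euclidean_iff)
    show "connected_space (top_of_set X)" 
      using connected_double[OF m(1,2)] connectedin_def[of euclidean "double m N"] by (simp add: X_def)
    show "\<forall>U x. openin (top_of_set X) U \<and> x \<in> U \<longrightarrow>
        (\<exists>V\<in>{V. openin (top_of_set X) V \<and> finite (top_of_set X frontier_of V)}. x \<in> V \<and> V \<subseteq> U)"
      using double_finite_frontier_base[OF m(2)] unfolding X_def by (metis (no_types, lifting) mem_Collect_eq)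
  qed auto
  have sac: "strongly_arc_connected n (mtopology_of d)"
    using strongly_arc_connected_double[OF m(1,3)] unfolding top X_def m(5) .
  have not_sac: "\<not> strongly_arc_connected (n + 1) (mtopology_of d)"
    using not_strongly_arc_connected_double[OF m(4)] unfolding top X_def m(6) .
  \<comment> \<open>Points of the double are determined by their coordinates and their height.\<close>
  define \<phi> :: "(real \<Rightarrow>\<^sub>C real) \<times> real \<Rightarrow> nat \<Rightarrow> real" where 
    "\<phi> q = case_nat (snd q) (coord (fst q))" for q
  have "inj_on \<phi> X"
  proof (rule inj_onI)
    fix q r assume qr: "q \<in> X" "r \<in> X" "\<phi> q = \<phi> r"
    have "snd q = snd r" "coord (fst q) i = coord (fst r) i" for i
      using fun_cong[OF qr(3), of 0] fun_cong[OF qr(3), of "Suc i"] by (simp_all add: \<phi>_def)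
    moreover have "fst q \<in> gasket N" "fst r \<in> gasket N" using qr by (auto simp: X_def double_def)
    ultimately show "q = r" using gasket_eqI by (metis order_refl prod_eqI)
  qed
  then have "inj_on \<phi> (mspace d)" by (simp add: d_def)
  then obtain d' where d': "homeomorphic_map (mtopology_of d) (mtopology_of d') \<phi>"
    by (rule transported_metric)
  then obtain \<psi> where \<psi>: "homeomorphic_map (mtopology_of d') (mtopology_of d) \<psi>"
    by (metis homeomorphic_map_maps homeomorphic_maps_sym)
  show ?thesis
  proof (intro exI[of _ d'] conjI notI)
    show "regular_continuum d'"
      by (rule regular_continuum_homeomorphic[OF d' regular])
    show "strongly_arc_connected n (mtopology_of d')"
      by (rule strongly_arc_connected_homeomorphic[OF d' sac])
    assume "strongly_arc_connected (n + 1) (mtopology_of d')"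
    then show False
      using strongly_arc_connected_homeomorphic[OF \<psi>] not_sac by blast
  qed
qed

end
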